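(* Let $z''\in S_{\ell_1''}$ be of the form $z''=z+\omega$ with $z\in B_{\ell_1}$ and $\omega\in\operatorname{Ext}_{\mathbb R}(\|\omega\|\,\overline B_{c_0^\perp})$. Then there is $\varphi\in\mathcal M_{z''}$ such that $\mathcal{GP}(\varphi)\neq\mathcal{GP}(\delta_{z''})$.
   Context: $\ell_1$ is the complex sequence space, $B_{\ell_1}$ its open unit ball, $S_{\ell_1''}$ and $\overline B_{\ell_1''}$ the unit sphere and closed unit ball of its bidual. One has $\ell_1''=\ell_\infty'=\ell_1\oplus_1 c_0^\perp$, where $c_0^\perp=\{\omega\in\ell_\infty':\omega|_{c_0}=0\}$, so $\|z+\omega\|=\|z\|+\|\omega\|$ for $z\in\ell_1,\ \omega\in c_0^\perp$. $\overline B_{c_0^\perp}$ is the closed unit ball of $c_0^\perp$, and for a ball $B$, $\operatorname{Ext}_{\mathbb R}(B)$ is the set of real extreme points of $B$ (extreme points in the usual sense of convex sets). $\mathcal A_u(B_{\ell_1})$ is the Banach algebra, with the supremum norm, of all uniformly continuous holomorphic functions $f:B_{\ell_1}\to\mathbb C$, and $\mathcal M(\mathcal A_u(B_{\ell_1}))$ is its spectrum: the set of all non-zero multiplicative linear functionals. The fiber over $z''\in\overline B_{\ell_1''}$ is $\mathcal M_{z''}=\{\varphi\in\mathcal M(\mathcal A_u(B_{\ell_1})): \varphi(x')=z''(x')\text{ for all }x'\in\ell_1'\}$. For $z''\in\overline B_{\ell_1''}$, $\delta_{z''}\in\mathcal M_{z''}$ is $\delta_{z''}(f)=\widetilde f(z'')$,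 where $\widetilde f$ is the canonical (Aron--Berner) extension of $f$: a continuous symmetric $m$-linear form $A$ on $\ell_1$ is extended to $\ell_1''$ by $\widetilde A(x_1'',\dots,x_m'')=\lim_{\alpha_1}\cdots\lim_{\alpha_m}A(x_{\alpha_1},\dots,x_{\alpha_m})$, where $(x_{\alpha_i})$ is a net in $\ell_1$ that is $w^*$-convergent to $x_i''$; the $m$-homogeneous polynomial $P(x)=A(x,\dots,x)$ is extended by $\widetilde P(x'')=\widetilde A(x'',\dots,x'')$; and $f=\sum_m P_m$ (Taylor series at $0$) is extended by $\widetilde f=\sum_m\widetilde P_m$ on $B_{\ell_1''}$ and by uniform continuity to $\overline B_{\ell_1''}$. The Gleason part of $\varphi$ is $\mathcal{GP}(\varphi)=\{\psi\in\mathcal M(\mathcal A_u(B_{\ell_1})): \|\varphi-\psi\|<2\}$, where $\|\varphi-\psi\|=\sup\{|\varphi(f)-\psi(f)|:\|f\|\le1\}$. *)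

theory Defs
  imports "HOL-Analysis.Analysis"
begin

section \<open>Complex normed spaces and their duals\<close>

class complex_normed_vector = real_normed_vector +
  fixes scaleC :: "complex \<Rightarrow> 'a \<Rightarrow> 'a"  (infixr \<open>*\<^sub>C\<close> 75)
  assumes scaleC_add_right: "c *\<^sub>C (x + y) = c *\<^sub>C x + c *\<^sub>C y"
    and scaleC_add_left: "(c + d) *\<^sub>C x = c *\<^sub>C x + d *\<^sub>C x"
    and scaleC_scaleC: "c *\<^sub>C d *\<^sub>C x = (c * d) *\<^sub>C x"
    and scaleC_of_real: "complex_of_real r *\<^sub>C x = r *\<^sub>R x"
    and norm_scaleC: "norm (c *\<^sub>C x) = cmod c * norm x"

definition clinear :: "('a::complex_normed_vector \<Rightarrow> complex) \<Rightarrow> bool" where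
  "clinear f \<longleftrightarrow> (\<forall>x y. f (x + y) = f x + f y) \<and> (\<forall>c x. f (c *\<^sub>C x) = c * f x)"

lemma clinear_zero: "clinear (\<lambda>x. 0)"
  and clinear_add: "clinear f \<Longrightarrow> clinear g \<Longrightarrow> clinear (\<lambda>x. f x + g x)"
  and clinear_minus: "clinear f \<Longrightarrow> clinear g \<Longrightarrow> clinear (\<lambda>x. f x - g x)"
  and clinear_uminus: "clinear f \<Longrightarrow> clinear (\<lambda>x. - f x)"
  and clinear_scale: "clinear f \<Longrightarrow> clinear (\<lambda>x. c * f x)"
  and clinear_scaleR: "clinear f \<Longrightarrow> clinear (\<lambda>x. r *\<^sub>R f x)"
  by (auto simp: clinear_def algebra_simps)

typedef (overloaded) 'a cdual =
  "{f :: 'a::complex_normed_vector \<Rightarrow> complex. clinear f \<and> bounded_linear f}"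
  morphisms cdual_apply Cdual
  by (rule exI[of _ "\<lambda>x. 0"]) (simp add: clinear_zero)

setup_lifting type_definition_cdual

instantiation cdual :: (complex_normed_vector) complex_normed_vector
begin

lift_definition norm_cdual :: "'a cdual \<Rightarrow> real" is onorm .

lift_definition zero_cdual :: "'a cdual" is "\<lambda>x. 0"
  by (simp add: clinear_zero)

lift_definition plus_cdual :: "'a cdual \<Rightarrow> 'a cdual \<Rightarrow> 'a cdual" is "\<lambda>f g x. f x + g x"
  by (simp add: clinear_add bounded_linear_add)

lift_definition minus_cdual :: "'a cdual \<Rightarrow> 'a cdual \<Rightarrow> 'a cdual" is "\<lambda>f g x. f x - g x"
  by (simp add: clinear_minus bounded_linear_sub)

lift_definition uminus_cdual :: "'a cdual \<Rightarrow> 'a cdual" is "\<lambda>f x. - f x"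
  by (simp add: clinear_uminus bounded_linear_minus)

lift_definition scaleR_cdual :: "real \<Rightarrow> 'a cdual \<Rightarrow> 'a cdual" is "\<lambda>r f x. r *\<^sub>R f x"
  by (metis clinear_scaleR bounded_linear_compose bounded_linear_scaleR_right)

lift_definition scaleC_cdual :: "complex \<Rightarrow> 'a cdual \<Rightarrow> 'a cdual" is "\<lambda>c f x. c * f x"
  by (simp add: clinear_scale bounded_linear_const_mult)

definition dist_cdual :: "'a cdual \<Rightarrow> 'a cdual \<Rightarrow> real"
  where "dist_cdual f g = norm (f - g)"

definition uniformity_cdual :: "('a cdual \<times> 'a cdual) filter"
  where "uniformity_cdual = (INF e\<in>{0 <..}. principal {(f, g). dist f g < e})"

definition open_cdual :: "'a cdual set \<Rightarrow> bool"
  where "open_cdual S = (\<forall>f\<in>S. \<forall>\<^sub>F (f', g) in uniformity. f' = f \<longrightarrow> g \<in> S)"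

definition sgn_cdual :: "'a cdual \<Rightarrow> 'a cdual"
  where "sgn_cdual f = inverse (norm f) *\<^sub>R f"

instance
proof
  fix f g h :: "'a cdual" and r s :: real and c d :: complex
  show "dist f g = norm (f - g)"
    by (rule dist_cdual_def)
  show "sgn f = inverse (norm f) *\<^sub>R f"
    by (rule sgn_cdual_def)
  show "(uniformity :: ('a cdual \<times> 'a cdual) filter) = (INF e\<in>{0 <..}. principal {(f, g). dist f g < e})"
    by (rule uniformity_cdual_def)
  show "open U = (\<forall>f\<in>U. \<forall>\<^sub>F (f', g) in uniformity. f' = f \<longrightarrow> g \<in> U)" for U :: "'a cdual set"
    by (rule open_cdual_def)
  show "norm (f + g) \<le> norm f + norm g"
    by transfer (simp add: onorm_triangle)
  show "norm (r *\<^sub>R f) = \<bar>r\<bar> * norm f"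
    by transfer (simp add: onorm_scaleR del: scaleR_conv_of_real)
  show "norm f = 0 \<longleftrightarrow> f = 0"
    by transfer (auto simp: onorm_eq_0)
  show "norm (c *\<^sub>C f) = cmod c * norm f"
  proof (transfer, elim conjE)
    fix c :: complex and f :: "'a \<Rightarrow> complex"
    assume f: "bounded_linear f"
    show "onorm (\<lambda>x. c * f x) = cmod c * onorm f"
    proof (rule antisym)
      show "onorm (\<lambda>x. c * f x) \<le> cmod c * onorm f"
        using onorm[OF f]
        by (intro onorm_bound)
          (auto simp: norm_mult mult.assoc onorm_pos_le[OF f] intro!: mult_left_mono mult_nonneg_nonneg)
      show "cmod c * onorm f \<le> onorm (\<lambda>x. c * f x)"
      proof (cases "c = 0")
        case True
        then show ?thesis
          by (simp add: onorm_zero)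
      next
        case False
        have cf: "bounded_linear (\<lambda>x. c * f x)"
          using f by (rule bounded_linear_const_mult)
        have "onorm f \<le> onorm (\<lambda>x. c * f x) / cmod c"
        proof (rule onorm_bound)
          show "0 \<le> onorm (\<lambda>x. c * f x) / cmod c"
            by (simp add: onorm_pos_le[OF cf])
          show "norm (f x) \<le> onorm (\<lambda>x. c * f x) / cmod c * norm x" for x
            using onorm[OF cf, of x] False
            by (simp add: norm_mult field_simps)
        qed
        then show ?thesis
          using False by (simp add: field_simps)
      qed
    qed
  qed
qed (transfer, simp add: algebra_simps scaleR_conv_of_real fun_eq_iff)+

end

lift_definition canonical_embedding :: "'a::complex_normed_vector \<Rightarrow> 'a cdual cdual"
  is "\<lambda>x x'. cdual_apply x' x"
proof
  fix x :: 'a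
  have bl: "bounded_linear (cdual_apply x')" for x' :: "'a cdual"
    using cdual_apply[of x'] by simp
  show "clinear (\<lambda>x'. cdual_apply x' x)"
    by (simp add: clinear_def plus_cdual.rep_eq scaleC_cdual.rep_eq)
  show "bounded_linear (\<lambda>x'. cdual_apply x' x)"
  proof (rule bounded_linear_intro[of _ "norm x"])
    show "cmod (cdual_apply x' x) \<le> norm x' * norm x" for x'
      using onorm[OF bl] by (simp add: norm_cdual.rep_eq)
  qed (simp_all add: plus_cdual.rep_eq scaleR_cdual.rep_eq)
qed

section \<open>The sequence space \<open>\<ell>\<^sub>1\<close> and the annihilator of \<open>c\<^sub>0\<close>\<close>

typedef ell1 = "{x :: nat \<Rightarrow> complex. summable (\<lambda>n. cmod (x n))}"
  morphisms ell1_coord Ell1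
  by (rule exI[of _ "\<lambda>n. 0"]) simp

setup_lifting type_definition_ell1

instantiation ell1 :: complex_normed_vector
begin

lift_definition norm_ell1 :: "ell1 \<Rightarrow> real" is "\<lambda>x. \<Sum>n. cmod (x n)" .

lift_definition zero_ell1 :: ell1 is "\<lambda>n. 0"
  by simp

lift_definition plus_ell1 :: "ell1 \<Rightarrow> ell1 \<Rightarrow> ell1" is "\<lambda>x y n. x n + y n"
proof -
  fix x y :: "nat \<Rightarrow> complex"
  assume "summable (\<lambda>n. cmod (x n))" "summable (\<lambda>n. cmod (y n))"
  then have "summable (\<lambda>n. cmod (x n) + cmod (y n))"
    by (rule summable_add)
  then show "summable (\<lambda>n. cmod (x n + y n))"
    by (rule summable_comparison_test'[where N = 0]) (simp add: norm_triangle_ineq)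
qed

lift_definition minus_ell1 :: "ell1 \<Rightarrow> ell1 \<Rightarrow> ell1" is "\<lambda>x y n. x n - y n"
proof -
  fix x y :: "nat \<Rightarrow> complex"
  assume "summable (\<lambda>n. cmod (x n))" "summable (\<lambda>n. cmod (y n))"
  then have "summable (\<lambda>n. cmod (x n) + cmod (y n))"
    by (rule summable_add)
  then show "summable (\<lambda>n. cmod (x n - y n))"
    by (rule summable_comparison_test'[where N = 0]) (simp add: norm_triangle_ineq4)
qed

lift_definition uminus_ell1 :: "ell1 \<Rightarrow> ell1" is "\<lambda>x n. - x n"
  by simp

lift_definition scaleR_ell1 :: "real \<Rightarrow> ell1 \<Rightarrow> ell1" is "\<lambda>r x n. r *\<^sub>R x n"
  by (simp add: norm_mult summable_mult)

lift_definition scaleC_ell1 :: "complex \<Rightarrow> ell1 \<Rightarrow> ell1" is "\<lambda>c x n. c * x n"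
  by (simp add: norm_mult summable_mult)

definition dist_ell1 :: "ell1 \<Rightarrow> ell1 \<Rightarrow> real"
  where "dist_ell1 x y = norm (x - y)"

definition uniformity_ell1 :: "(ell1 \<times> ell1) filter"
  where "uniformity_ell1 = (INF e\<in>{0 <..}. principal {(x, y). dist x y < e})"

definition open_ell1 :: "ell1 set \<Rightarrow> bool"
  where "open_ell1 S = (\<forall>x\<in>S. \<forall>\<^sub>F (x', y) in uniformity. x' = x \<longrightarrow> y \<in> S)"

definition sgn_ell1 :: "ell1 \<Rightarrow> ell1"
  where "sgn_ell1 x = inverse (norm x) *\<^sub>R x"

instance
proof
  fix x y :: ell1 and r :: real and c :: complex
  show "dist x y = norm (x - y)"
    by (rule dist_ell1_def)
  show "sgn x = inverse (norm x) *\<^sub>R x"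
    by (rule sgn_ell1_def)
  show "(uniformity :: (ell1 \<times> ell1) filter) = (INF e\<in>{0 <..}. principal {(x, y). dist x y < e})"
    by (rule uniformity_ell1_def)
  show "open U = (\<forall>x\<in>U. \<forall>\<^sub>F (x', y) in uniformity. x' = x \<longrightarrow> y \<in> U)" for U :: "ell1 set"
    by (rule open_ell1_def)
  show "norm (x + y) \<le> norm x + norm y"
  proof transfer
    fix x y :: "nat \<Rightarrow> complex"
    assume x: "summable (\<lambda>n. cmod (x n))" and y: "summable (\<lambda>n. cmod (y n))"
    have xy: "summable (\<lambda>n. cmod (x n) + cmod (y n))"
      using x y by (rule summable_add)
    have s: "summable (\<lambda>n. cmod (x n + y n))"
      by (rule summable_comparison_test'[OF xy, of 0]) (auto intro: norm_triangle_ineq)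
    have "(\<Sum>n. cmod (x n + y n)) \<le> (\<Sum>n. cmod (x n) + cmod (y n))"
      by (intro suminf_le s xy norm_triangle_ineq)
    then show "(\<Sum>n. cmod (x n + y n)) \<le> (\<Sum>n. cmod (x n)) + (\<Sum>n. cmod (y n))"
      using suminf_add[OF x y] by simp
  qed
  show "norm (r *\<^sub>R x) = \<bar>r\<bar> * norm x"
    by transfer (simp add: norm_mult suminf_mult)
  show "norm (c *\<^sub>C x) = cmod c * norm x"
    by transfer (simp add: norm_mult suminf_mult)
  show "norm x = 0 \<longleftrightarrow> x = 0"
    by transfer (auto simp: suminf_eq_zero_iff)
qed (transfer, simp add: algebra_simps scaleR_conv_of_real fun_eq_iff)+

end

lift_definition unit_vector :: "nat \<Rightarrow> ell1" is "\<lambda>k n. if n = k then 1 else 0"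
  by (rule summable_finite[of "{k}" for k]) auto

text \<open>
  Under \<open>\<ell>\<^sub>1' = \<ell>\<^sub>\<infinity>\<close> a functional \<open>x'\<close> corresponds to the bounded sequence
  \<open>(x'(e\<^sub>n))\<^sub>n\<close>; so \<open>c0\<close> is a subspace of \<open>\<ell>\<^sub>1'\<close> and its annihilator a subspace
  of \<open>\<ell>\<^sub>1''\<close>.
\<close>

definition c0 :: "ell1 cdual set" where
  "c0 = {x'. (\<lambda>n. cdual_apply x' (unit_vector n)) \<longlonglongrightarrow> 0}"

definition c0_perp :: "ell1 cdual cdual set" where
  "c0_perp = {\<omega>. \<forall>x'\<in>c0. cdual_apply \<omega> x' = 0}"

section \<open>The algebra of uniformly continuous holomorphic functions on the unit ball\<close>

definition fholomorphic_on :: "('a::complex_normed_vector \<Rightarrow> complex) \<Rightarrow> 'a set \<Rightarrow> bool" where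
  "fholomorphic_on f U \<longleftrightarrow> (\<forall>x\<in>U. \<exists>D. clinear D \<and> (f has_derivative D) (at x))"

lemma uniformly_continuous_on_ball_bounded:
  fixes f :: "'a::real_normed_vector \<Rightarrow> complex"
  assumes "uniformly_continuous_on (ball 0 1) f"
  obtains C where "\<And>x. x \<in> ball 0 1 \<Longrightarrow> cmod (f x) \<le> C"
proof -
  obtain d where d: "d > 0" "\<And>x y. x \<in> ball 0 1 \<Longrightarrow> y \<in> ball 0 1 \<Longrightarrow> dist y x < d \<Longrightarrow> dist (f y) (f x) < 1"
    using assms unfolding uniformly_continuous_on_def by (metis zero_less_one)
  obtain N :: nat where N: "1 / d < real N"
    using reals_Archimedean2 by blast
  then have N0: "0 < real N"
    using d(1) by (meson divide_pos_pos less_trans zero_less_one)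
  have "cmod (f x) \<le> cmod (f 0) + real N" if x: "x \<in> ball 0 1" for x
  proof -
    have in_ball: "(real k / real N) *\<^sub>R x \<in> ball 0 1" if "k \<le> N" for k
    proof -
      have "real k / real N \<le> 1"
        using that N0 by simp
      then have "norm ((real k / real N) *\<^sub>R x) \<le> norm x"
        using N0 mult_left_le_one_le[of "norm x" "real k / real N"] by simp
      then show ?thesis
        using x by simp
    qed
    have "cmod (f ((real k / real N) *\<^sub>R x)) \<le> cmod (f 0) + real k" if "k \<le> N" for k
      using that
    proof (induction k)
      case 0
      then show ?case by simp
    next
      case (Suc k)
      have "(real (Suc k) / real N) *\<^sub>R x - (real k / real N) *\<^sub>R x = (1 / real N) *\<^sub>R x"
        by (simp flip: scaleR_diff_left diff_divide_distrib)
      then have "dist ((real (Suc k) / real N) *\<^sub>R x) ((real k / real N) *\<^sub>R x) = norm x / real N"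
        by (simp add: dist_norm)
      also have "\<dots> < d"
      proof -
        have "1 < d * real N"
          using N d(1) by (simp add: field_simps)
        then have "norm x < d * real N"
          using x by simp
        then show ?thesis
          using N0 by (simp add: field_simps)
      qed
      finally have "dist (f ((real (Suc k) / real N) *\<^sub>R x)) (f ((real k / real N) *\<^sub>R x)) < 1"
        using Suc.prems by (intro d(2) in_ball) auto
      then have "cmod (f ((real (Suc k) / real N) *\<^sub>R x)) \<le> cmod (f ((real k / real N) *\<^sub>R x)) + 1"
        unfolding dist_norm by (smt (verit) norm_triangle_ineq2)
      then show ?case
        using Suc by simp
    qed
    from this[of N] show ?thesis
      using N0 by simp
  qed
  then show thesis
    by (rule that)
qed

lemma uniformly_continuous_on_ball_mult:
  fixes f g :: "'a::real_normed_vector \<Rightarrow> complex"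
  assumes f: "uniformly_continuous_on (ball 0 1) f" and g: "uniformly_continuous_on (ball 0 1) g"
  shows "uniformly_continuous_on (ball 0 1) (\<lambda>x. f x * g x)"
  unfolding uniformly_continuous_on_def
proof (intro allI impI)
  fix e :: real
  assume e: "e > 0"
  obtain C where C: "\<And>x. x \<in> ball 0 1 \<Longrightarrow> cmod (f x) \<le> C"
    using uniformly_continuous_on_ball_bounded[OF f] by blast
  obtain D where D: "\<And>x. x \<in> ball 0 1 \<Longrightarrow> cmod (g x) \<le> D"
    using uniformly_continuous_on_ball_bounded[OF g] by blast
  define K where "K = C + D + 1"
  have "0 \<le> C" "0 \<le> D"
    using order_trans[OF norm_ge_zero C[of 0]] order_trans[OF norm_ge_zero D[of 0]] by simp_all
  then have K: "K > 0" "C \<le> K" "D \<le> K"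
    unfolding K_def by simp_all
  define \<eta> where "\<eta> = e / (2 * K)"
  have \<eta>: "\<eta> > 0"
    using e K by (simp add: \<eta>_def)
  obtain d1 where d1: "d1 > 0"
    "\<And>x y. x \<in> ball 0 1 \<Longrightarrow> y \<in> ball 0 1 \<Longrightarrow> dist y x < d1 \<Longrightarrow> dist (f y) (f x) < \<eta>"
    using f \<eta> unfolding uniformly_continuous_on_def by meson
  obtain d2 where d2: "d2 > 0"
    "\<And>x y. x \<in> ball 0 1 \<Longrightarrow> y \<in> ball 0 1 \<Longrightarrow> dist y x < d2 \<Longrightarrow> dist (g y) (g x) < \<eta>"
    using g \<eta> unfolding uniformly_continuous_on_def by meson
  have "dist (f y * g y) (f x * g x) < e"
    if x: "x \<in> ball 0 1" and y: "y \<in> ball 0 1" and xy: "dist y x < min d1 d2" for x y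
  proof -
    have eq: "f y * g y - f x * g x = f y * (g y - g x) + g x * (f y - f x)"
      by (simp add: algebra_simps)
    have "dist (f y * g y) (f x * g x) \<le> cmod (f y) * cmod (g y - g x) + cmod (g x) * cmod (f y - f x)"
      unfolding dist_norm eq by (metis norm_triangle_ineq norm_mult)
    also have "\<dots> \<le> K * cmod (g y - g x) + K * cmod (f y - f x)"
      using C[OF y] D[OF x] K by (intro add_mono mult_right_mono) auto
    also have "\<dots> < K * \<eta> + K * \<eta>"
      using d1(2)[OF x y] d2(2)[OF x y] xy K(1)
      by (intro add_strict_mono mult_strict_left_mono) (auto simp: dist_norm)
    also have "\<dots> = e"
      using K(1) by (simp add: \<eta>_def)
    finally show ?thesis .
  qed
  then show "\<exists>d>0. \<forall>x\<in>ball 0 1. \<forall>x'\<in>ball 0 1. dist x' x < d \<longrightarrow> dist (f x' * g x') (f x * g x) < e"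
    using d1(1) d2(1) by (metis min_less_iff_conj)
qed

lemma uniformly_continuous_on_transform:
  fixes f g :: "'a::metric_space \<Rightarrow> 'b::metric_space"
  assumes "\<And>x. x \<in> S \<Longrightarrow> f x = g x" "uniformly_continuous_on S f"
  shows "uniformly_continuous_on S g"
  using assms by (simp add: uniformly_continuous_on_def)

lemma fholomorphic_on_zero: "fholomorphic_on (\<lambda>x. 0) U"
  unfolding fholomorphic_on_def by (intro ballI exI[of _ "\<lambda>x. 0"] conjI clinear_zero has_derivative_const)

lemma fholomorphic_on_const: "fholomorphic_on (\<lambda>x. c) U"
  unfolding fholomorphic_on_def by (intro ballI exI[of _ "\<lambda>x. 0"] conjI clinear_zero has_derivative_const)

lemma fholomorphic_onE:
  assumes "fholomorphic_on f U" "x \<in> U"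
  obtains D where "clinear D" "(f has_derivative D) (at x)"
  using assms unfolding fholomorphic_on_def by auto

lemma fholomorphic_onI:
  assumes "\<And>x. x \<in> U \<Longrightarrow> \<exists>D. clinear D \<and> (f has_derivative D) (at x)"
  shows "fholomorphic_on f U"
  using assms unfolding fholomorphic_on_def by auto

lemma fholomorphic_on_add:
  assumes f: "fholomorphic_on f U" and g: "fholomorphic_on g U"
  shows "fholomorphic_on (\<lambda>x. f x + g x) U"
proof (rule fholomorphic_onI)
  fix x assume x: "x \<in> U"
  obtain D where D: "clinear D" "(f has_derivative D) (at x)"
    using f x by (rule fholomorphic_onE)
  obtain E where E: "clinear E" "(g has_derivative E) (at x)"
    using g x by (rule fholomorphic_onE)
  show "\<exists>D. clinear D \<and> ((\<lambda>x. f x + g x) has_derivative D) (at x)"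
    by (rule exI, rule conjI, rule clinear_add[OF D(1) E(1)], rule has_derivative_add[OF D(2) E(2)])
qed

lemma fholomorphic_on_diff:
  assumes f: "fholomorphic_on f U" and g: "fholomorphic_on g U"
  shows "fholomorphic_on (\<lambda>x. f x - g x) U"
proof (rule fholomorphic_onI)
  fix x assume x: "x \<in> U"
  obtain D where D: "clinear D" "(f has_derivative D) (at x)"
    using f x by (rule fholomorphic_onE)
  obtain E where E: "clinear E" "(g has_derivative E) (at x)"
    using g x by (rule fholomorphic_onE)
  show "\<exists>D. clinear D \<and> ((\<lambda>x. f x - g x) has_derivative D) (at x)"
    by (rule exI, rule conjI, rule clinear_minus[OF D(1) E(1)], rule has_derivative_diff[OF D(2) E(2)])
qed

lemma fholomorphic_on_mult:
  assumes f: "fholomorphic_on f U" and g: "fholomorphic_on g U"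
  shows "fholomorphic_on (\<lambda>x. f x * g x) U"
proof (rule fholomorphic_onI)
  fix x assume x: "x \<in> U"
  obtain D where D: "clinear D" "(f has_derivative D) (at x)"
    using f x by (rule fholomorphic_onE)
  obtain E where E: "clinear E" "(g has_derivative E) (at x)"
    using g x by (rule fholomorphic_onE)
  have "clinear (\<lambda>h. f x * E h + D h * g x)"
    using D(1) E(1) by (auto simp: clinear_def algebra_simps)
  with has_derivative_mult[OF D(2) E(2)]
  show "\<exists>D. clinear D \<and> ((\<lambda>x. f x * g x) has_derivative D) (at x)"
    by (intro exI conjI)
qed

lemma fholomorphic_on_cong:
  assumes "open U" "\<And>x. x \<in> U \<Longrightarrow> f x = g x" "fholomorphic_on f U"
  shows "fholomorphic_on g U"
proof (rule fholomorphic_onI)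
  fix x assume x: "x \<in> U"
  obtain D where "clinear D" "(f has_derivative D) (at x)"
    using assms(3) x by (rule fholomorphic_onE)
  then show "\<exists>D. clinear D \<and> (g has_derivative D) (at x)"
    using has_derivative_transform_within_open[OF _ assms(1) x assms(2)] by (intro exI[of _ D]) simp
qed

lemma fholomorphic_on_clinear:
  "clinear f \<Longrightarrow> bounded_linear f \<Longrightarrow> fholomorphic_on f U"
  unfolding fholomorphic_on_def by (intro ballI exI[of _ f] conjI bounded_linear_imp_has_derivative)

text \<open>
  Functions on the open unit ball are represented by total functions vanishing off the ball, so
  that equality of elements of \<open>'a Au\<close> is equality on the ball.
\<close>

typedef (overloaded) 'a Au =
  "{f :: 'a::complex_normed_vector \<Rightarrow> complex.
      uniformly_continuous_on (ball 0 1) f \<and> fholomorphic_on f (ball 0 1) \<and> (\<forall>x. x \<notin> ball 0 1 \<longrightarrow> f x = 0)}"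
  morphisms Au_apply Au
  by (rule exI[of _ "\<lambda>x. 0"]) (simp add: uniformly_continuous_on_const fholomorphic_on_zero)

setup_lifting type_definition_Au

instantiation Au :: (complex_normed_vector) "{comm_ring_1, complex_normed_vector}"
begin

lift_definition norm_Au :: "'a Au \<Rightarrow> real" is "\<lambda>f. SUP x\<in>ball 0 1. cmod (f x)" .

lift_definition zero_Au :: "'a Au" is "\<lambda>x. 0"
  by (simp add: uniformly_continuous_on_const fholomorphic_on_zero)

lift_definition one_Au :: "'a Au" is "\<lambda>x. if x \<in> ball 0 1 then 1 else 0"
proof (intro conjI)
  show "uniformly_continuous_on (ball 0 1) (\<lambda>x::'a. if x \<in> ball 0 1 then 1 else 0::complex)"
    by (rule uniformly_continuous_on_transform[OF _ uniformly_continuous_on_const]) simp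
  show "fholomorphic_on (\<lambda>x::'a. if x \<in> ball 0 1 then 1 else 0) (ball 0 1)"
    by (rule fholomorphic_on_cong[OF open_ball _ fholomorphic_on_const]) simp
qed simp

lift_definition plus_Au :: "'a Au \<Rightarrow> 'a Au \<Rightarrow> 'a Au" is "\<lambda>f g x. f x + g x"
  by (simp add: uniformly_continuous_on_add fholomorphic_on_add)

lift_definition minus_Au :: "'a Au \<Rightarrow> 'a Au \<Rightarrow> 'a Au" is "\<lambda>f g x. f x - g x"
  by (simp add: uniformly_continuous_on_diff fholomorphic_on_diff)

lift_definition uminus_Au :: "'a Au \<Rightarrow> 'a Au" is "\<lambda>f x. - f x"
  using fholomorphic_on_diff[OF fholomorphic_on_zero]
  by (auto simp: uniformly_continuous_on_minus)

lift_definition times_Au :: "'a Au \<Rightarrow> 'a Au \<Rightarrow> 'a Au" is "\<lambda>f g x. f x * g x"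
  by (simp add: uniformly_continuous_on_ball_mult fholomorphic_on_mult)

lift_definition scaleC_Au :: "complex \<Rightarrow> 'a Au \<Rightarrow> 'a Au" is "\<lambda>c f x. c * f x"
  by (simp add: uniformly_continuous_on_ball_mult uniformly_continuous_on_const
      fholomorphic_on_mult fholomorphic_on_const)

lift_definition scaleR_Au :: "real \<Rightarrow> 'a Au \<Rightarrow> 'a Au" is "\<lambda>r f x. complex_of_real r * f x"
  by (simp add: uniformly_continuous_on_ball_mult uniformly_continuous_on_const
      fholomorphic_on_mult fholomorphic_on_const)

definition dist_Au :: "'a Au \<Rightarrow> 'a Au \<Rightarrow> real"
  where "dist_Au f g = norm (f - g)"

definition uniformity_Au :: "('a Au \<times> 'a Au) filter"
  where "uniformity_Au = (INF e\<in>{0 <..}. principal {(f, g). dist f g < e})"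

definition open_Au :: "'a Au set \<Rightarrow> bool"
  where "open_Au S = (\<forall>f\<in>S. \<forall>\<^sub>F (f', g) in uniformity. f' = f \<longrightarrow> g \<in> S)"

definition sgn_Au :: "'a Au \<Rightarrow> 'a Au"
  where "sgn_Au f = inverse (norm f) *\<^sub>R f"

lemmas Au_rep_eqs = zero_Au.rep_eq one_Au.rep_eq plus_Au.rep_eq minus_Au.rep_eq uminus_Au.rep_eq
  times_Au.rep_eq scaleC_Au.rep_eq scaleR_Au.rep_eq

lemma Au_eqI: "(\<And>x. Au_apply f x = Au_apply g x) \<Longrightarrow> f = g"
  by (simp add: Au_apply_inject[symmetric] fun_eq_iff)

lemma Au_off_ball: "\<not> norm x < 1 \<Longrightarrow> Au_apply f x = 0"
  using Au_apply[of f] by simp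

lemma Au_apply_le_norm: "cmod (Au_apply f x) \<le> norm f"
proof -
  have uc: "uniformly_continuous_on (ball 0 1) (Au_apply f)"
    and off: "x \<notin> ball 0 1 \<Longrightarrow> Au_apply f x = 0" for x
    using Au_apply[of f] by blast+
  obtain C where C: "\<And>x. x \<in> ball 0 1 \<Longrightarrow> cmod (Au_apply f x) \<le> C"
    using uniformly_continuous_on_ball_bounded[OF uc] by blast
  have bdd: "bdd_above ((\<lambda>x. cmod (Au_apply f x)) ` ball 0 1)"
    using C by (auto intro!: bdd_aboveI)
  have up: "cmod (Au_apply f y) \<le> norm f" if "y \<in> ball 0 1" for y
    unfolding norm_Au.rep_eq using that bdd by (rule cSUP_upper)
  have "0 \<le> norm f"
    using up[of 0] norm_ge_zero[of "Au_apply f 0"] by (simp del: norm_ge_zero)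
  then show ?thesis
    using up off by (cases "x \<in> ball 0 1") auto
qed

lemma norm_Au_le: "(\<And>x. x \<in> ball 0 1 \<Longrightarrow> cmod (Au_apply f x) \<le> C) \<Longrightarrow> norm f \<le> C"
  unfolding norm_Au.rep_eq by (rule cSUP_least) auto

instance
proof
  fix f g :: "'a Au" and r :: real and c :: complex
  show "dist f g = norm (f - g)"
    by (rule dist_Au_def)
  show "sgn f = inverse (norm f) *\<^sub>R f"
    by (rule sgn_Au_def)
  show "(uniformity :: ('a Au \<times> 'a Au) filter) = (INF e\<in>{0 <..}. principal {(f, g). dist f g < e})"
    by (rule uniformity_Au_def)
  show "open U = (\<forall>f\<in>U. \<forall>\<^sub>F (f', g) in uniformity. f' = f \<longrightarrow> g \<in> U)" for U :: "'a Au set"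
    by (rule open_Au_def)
  have "cmod (Au_apply f x + Au_apply g x) \<le> norm f + norm g" for x
    by (rule norm_triangle_le) (intro add_mono Au_apply_le_norm)
  then show "norm (f + g) \<le> norm f + norm g"
    by (intro norm_Au_le) (simp add: plus_Au.rep_eq)
  show nC: "norm (c *\<^sub>C f) = cmod c * norm f" for c
  proof (rule antisym)
    show "norm (c *\<^sub>C f) \<le> cmod c * norm f"
      by (rule norm_Au_le) (simp add: scaleC_Au.rep_eq norm_mult mult_left_mono Au_apply_le_norm)
    show "cmod c * norm f \<le> norm (c *\<^sub>C f)"
    proof (cases "c = 0")
      case True
      have "0 \<le> norm (c *\<^sub>C f)"
        using Au_apply_le_norm[of "c *\<^sub>C f" 0] norm_ge_zero order_trans by blast
      then show ?thesis
        using True by simp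
    next
      case False
      have "norm f \<le> norm (c *\<^sub>C f) / cmod c"
      proof (rule norm_Au_le)
        show "cmod (Au_apply f x) \<le> norm (c *\<^sub>C f) / cmod c" for x
          using Au_apply_le_norm[of "c *\<^sub>C f" x] False
          by (simp add: scaleC_Au.rep_eq norm_mult field_simps)
      qed
      then show ?thesis
        using False by (simp add: field_simps)
    qed
  qed
  have RC: "r *\<^sub>R f = complex_of_real r *\<^sub>C f"
    by (rule Au_eqI) (simp add: Au_rep_eqs)
  then show "complex_of_real r *\<^sub>C f = r *\<^sub>R f"
    by simp
  show "norm (r *\<^sub>R f) = \<bar>r\<bar> * norm f"
    by (simp add: RC nC)
  show "norm f = 0 \<longleftrightarrow> f = 0"
  proof
    assume "norm f = 0"
    then have "Au_apply f x = 0" for x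
      using Au_apply_le_norm[of f x] by simp
    then show "f = 0"
      by (simp add: Au_apply_inject[symmetric] zero_Au.rep_eq fun_eq_iff)
  next
    assume "f = 0"
    then show "norm f = 0"
      by (simp add: norm_Au.rep_eq zero_Au.rep_eq)
  qed
  have "Au_apply (0::'a Au) 0 \<noteq> Au_apply 1 0"
    by (simp add: zero_Au.rep_eq one_Au.rep_eq)
  then show "(0::'a Au) \<noteq> 1"
    by metis
qed (rule Au_eqI, simp add: Au_rep_eqs Au_off_ball algebra_simps)+

end

instance Au :: (complex_normed_vector) real_normed_algebra_1
proof
  fix f g :: "'a Au" and r :: real
  show "norm (f * g) \<le> norm f * norm g"
    by (rule norm_Au_le) (simp add: times_Au.rep_eq norm_mult mult_mono Au_apply_le_norm)
  show "norm (1 :: 'a Au) = 1"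
    by (simp add: norm_Au.rep_eq one_Au.rep_eq)
qed (rule Au_eqI, simp add: Au_rep_eqs Au_off_ball algebra_simps)+

lift_definition Au_of_cdual :: "'a::complex_normed_vector cdual \<Rightarrow> 'a Au"
  is "\<lambda>x' x. if x \<in> ball 0 1 then x' x else 0"
proof (elim conjE, intro conjI)
  fix x' :: "'a \<Rightarrow> complex"
  assume x': "clinear x'" "bounded_linear x'"
  show "uniformly_continuous_on (ball 0 1) (\<lambda>x. if x \<in> ball 0 1 then x' x else 0)"
    by (rule uniformly_continuous_on_transform[OF _
          bounded_linear.uniformly_continuous_on[OF x'(2) uniformly_continuous_on_id]]) simp
  show "fholomorphic_on (\<lambda>x. if x \<in> ball 0 1 then x' x else 0) (ball 0 1)"
    by (rule fholomorphic_on_cong[OF open_ball _ fholomorphic_on_clinear[OF x']]) simp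
qed auto

section \<open>The Aron--Berner extension\<close>

text \<open>
  An \<open>m\<close>-linear form is a function on lists, of which only the values on lists of length \<open>m\<close>
  are relevant. Continuity is expressed by boundedness.
\<close>

definition sym_mlinear_form :: "nat \<Rightarrow> ('a::complex_normed_vector list \<Rightarrow> complex) \<Rightarrow> bool" where
  "sym_mlinear_form m A \<longleftrightarrow>
     (\<forall>xs i. length xs = m \<longrightarrow> i < m \<longrightarrow> clinear (\<lambda>x. A (xs[i := x]))) \<and>
     (\<exists>C. \<forall>xs. length xs = m \<longrightarrow> cmod (A xs) \<le> C * (\<Prod>x\<leftarrow>xs. norm x)) \<and>
     (\<forall>xs ys. length xs = m \<longrightarrow> mset xs = mset ys \<longrightarrow> A xs = A ys)"

definition homogeneous_poly :: "nat \<Rightarrow> ('a::complex_normed_vector \<Rightarrow> complex) \<Rightarrow> bool" where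
  "homogeneous_poly m P \<longleftrightarrow> (\<exists>A. sym_mlinear_form m A \<and> (\<forall>x. P x = A (replicate m x)))"

text \<open>
  The trace on \<open>'a\<close> of the filter of weak-star neighbourhoods of \<open>x''\<close>: a net in \<open>'a\<close> is
  weak-star convergent to \<open>x''\<close> iff its tail filter is finer than this one. The topology on
  \<^typ>\<open>'a cdual \<Rightarrow> complex\<close> is that of pointwise convergence.
\<close>

definition wstar_filter :: "'a::complex_normed_vector cdual cdual \<Rightarrow> 'a filter" where
  "wstar_filter x'' =
     filtercomap (\<lambda>x. cdual_apply (canonical_embedding x)) (nhds (cdual_apply x''))"

text \<open>\<open>lim\<^bsub>x\<^sub>1 \<rightarrow> x\<^sub>1''\<^esub> \<dots> lim\<^bsub>x\<^sub>m \<rightarrow> x\<^sub>m''\<^esub> A(x\<^sub>1,\<dots>,x\<^sub>m)\<close>, the limit in the last variable being innermost.\<close>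

fun mlinear_extension ::
  "('a::complex_normed_vector list \<Rightarrow> complex) \<Rightarrow> 'a cdual cdual list \<Rightarrow> complex" where
  "mlinear_extension A [] = A []"
| "mlinear_extension A (x'' # xs'') =
     Lim (wstar_filter x'') (\<lambda>x. mlinear_extension (\<lambda>xs. A (x # xs)) xs'')"

text \<open>By polarization the form \<open>A\<close> chosen here is unique on lists of length \<open>m\<close>.\<close>

definition poly_extension ::
  "nat \<Rightarrow> ('a::complex_normed_vector \<Rightarrow> complex) \<Rightarrow> 'a cdual cdual \<Rightarrow> complex" where
  "poly_extension m P x'' =
     mlinear_extension (SOME A. sym_mlinear_form m A \<and> (\<forall>x. P x = A (replicate m x))) (replicate m x'')"

definition taylor_poly :: "'a::complex_normed_vector Au \<Rightarrow> nat \<Rightarrow> 'a \<Rightarrow> complex" where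
  "taylor_poly f = (THE P. (\<forall>m. homogeneous_poly m (P m)) \<and>
     (\<forall>x\<in>ball 0 1. (\<lambda>m. P m x) sums Au_apply f x))"

definition ball_extension :: "'a::complex_normed_vector Au \<Rightarrow> 'a cdual cdual \<Rightarrow> complex" where
  "ball_extension f x'' = (\<Sum>m. poly_extension m (taylor_poly f m) x'')"

definition aron_berner :: "'a::complex_normed_vector Au \<Rightarrow> 'a cdual cdual \<Rightarrow> complex" where
  "aron_berner f x'' =
     (if x'' \<in> ball 0 1 then ball_extension f x''
      else Lim (at x'' within ball 0 1) (ball_extension f))"

section \<open>Spectrum, fibers and Gleason parts\<close>

definition spectrum :: "('a::complex_normed_vector Au \<Rightarrow> complex) set" where
  "spectrum = {\<phi>. clinear \<phi> \<and> (\<forall>f g. \<phi> (f * g) = \<phi> f * \<phi> g) \<and> (\<exists>f. \<phi> f \<noteq> 0)}"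

definition fiber :: "'a::complex_normed_vector cdual cdual \<Rightarrow> ('a Au \<Rightarrow> complex) set" where
  "fiber x'' = {\<phi> \<in> spectrum. \<forall>x'. \<phi> (Au_of_cdual x') = cdual_apply x'' x'}"

definition evaluation :: "'a::complex_normed_vector cdual cdual \<Rightarrow> 'a Au \<Rightarrow> complex" where
  "evaluation x'' = (\<lambda>f. aron_berner f x'')"

text \<open>The supremum is taken in \<^typ>\<open>ereal\<close>, so that it is meaningful for unbounded \<open>\<phi> - \<psi>\<close> too.\<close>

definition functional_dist ::
  "('a::complex_normed_vector Au \<Rightarrow> complex) \<Rightarrow> ('a Au \<Rightarrow> complex) \<Rightarrow> ereal" where
  "functional_dist \<phi> \<psi> = (SUP f\<in>{f. norm f \<le> 1}. ereal (cmod (\<phi> f - \<psi> f)))"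

definition gleason_part ::
  "('a::complex_normed_vector Au \<Rightarrow> complex) \<Rightarrow> ('a Au \<Rightarrow> complex) set" where
  "gleason_part \<phi> = {\<psi> \<in> spectrum. functional_dist \<phi> \<psi> < 2}"

end

theory Submission
  imports Defs
begin

text \<open>
  It suffices to find two elements of the fiber at distance \<open>2\<close>: their Gleason parts differ, so at
  least one of them differs from that of \<open>\<delta>\<^bsub>z''\<^esub>\<close>, and the Aron--Berner extension need not be computed.

  Extremality makes \<open>\<omega>\<close> a multiple \<open>c lim\<^bsub>n \<rightarrow> p\<^esub>\<close> of the limit along a free ultrafilter \<open>p\<close>, with
  \<open>\<bar>c\<bar> = \<parallel>\<omega>\<parallel> = 1 - \<parallel>z\<parallel>\<close>. The limits of \<open>f (z + c e\<^sub>n)\<close> as \<open>n \<rightarrow> p\<close> and of \<open>f (z + c (e\<^sub>n + e\<^sub>m) / 2)\<close> as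
  \<open>m \<rightarrow> p\<close> and then \<open>n \<rightarrow> p\<close> both define characters in the fiber over \<open>z''\<close> (the points are scaled
  into the open ball). There are \<open>2\<close>-homogeneous polynomials \<open>g\<^sub>N\<close> bounded by \<open>1\<close> on the ball whose
  values tend to \<open>1\<close> at the first character and to \<open>1 - \<parallel>\<omega>\<parallel>\<^sup>2 / 2\<close> at the second; composing them
  with automorphisms of the disc separates the two by \<open>2\<close>.
\<close>

section \<open>Ultrafilters\<close>

text \<open>The dichotomy is maximality among proper filters. Using the type of filters makes
  convergence along an ultrafilter the usual one.\<close>

definition ultrafilter :: "'a filter \<Rightarrow> bool" where
  "ultrafilter F \<longleftrightarrow> F \<noteq> bot \<and> (\<forall>P. eventually P F \<or> eventually (\<lambda>x. \<not> P x) F)"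

lemma ultrafilter_not_bot: "ultrafilter F \<Longrightarrow> F \<noteq> bot"
  unfolding ultrafilter_def by (rule conjunct1)

lemma ultrafilter_cases:
  assumes "ultrafilter F"
  obtains "eventually P F" | "eventually (\<lambda>x. \<not> P x) F"
  using assms unfolding ultrafilter_def by blast

text \<open>Compactness yields a cluster point \<open>l\<close> of the values. Along an ultrafilter
  it is a limit, since otherwise the values would eventually avoid a neighbourhood of
  \<open>l\<close>.\<close>

lemma ultrafilter_tendsto:
  fixes f :: "'a \<Rightarrow> 'b::heine_borel"
  assumes F: "ultrafilter F" and f: "bounded (range f)"
  obtains l where "(f \<longlongrightarrow> l) F"
proof -
  have "compact (closure (range f))"
    using f by simp
  moreover have "filtermap f F \<noteq> bot"
    using ultrafilter_not_bot[OF F] by (simp add: filtermap_bot_iff)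
  moreover have "f x \<in> closure (range f)" for x
    using closure_subset by fast
  then have "eventually (\<lambda>y. y \<in> closure (range f)) (filtermap f F)"
    by (simp add: eventually_filtermap)
  ultimately obtain l where l: "inf (nhds l) (filtermap f F) \<noteq> bot"
    unfolding compact_filter by metis
  have "(f \<longlongrightarrow> l) F"
  proof (rule topological_tendstoI)
    fix S assume S: "open S" "l \<in> S"
    from F show "eventually (\<lambda>x. f x \<in> S) F"
    proof (rule ultrafilter_cases[where P = "\<lambda>x. f x \<in> S"])
      assume "eventually (\<lambda>x. f x \<notin> S) F"
      then have "eventually (\<lambda>y. y \<notin> S) (filtermap f F)"
        by (simp add: eventually_filtermap)
      then have "eventually (\<lambda>y. y \<notin> S) (inf (nhds l) (filtermap f F))"
        by (rule filter_leD[OF inf_le2])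
      moreover have "eventually (\<lambda>y. y \<in> S) (inf (nhds l) (filtermap f F))"
        using S by (intro filter_leD[OF inf_le1] eventually_nhds_in_open)
      ultimately have "eventually (\<lambda>y. False) (inf (nhds l) (filtermap f F))"
        by eventually_elim simp
      with l show ?thesis
        by (simp add: eventually_False)
    qed
  qed
  then show thesis
    by (rule that)
qed

text \<open>The square of \<open>F\<close> in the sense of iterated limits: the first component is
  the outer variable, the second the inner one.\<close>

definition iterated_filter :: "'a filter \<Rightarrow> ('a \<times> 'a) filter" where
  "iterated_filter F = Abs_filter (\<lambda>P. eventually (\<lambda>x. eventually (\<lambda>y. P (x, y)) F) F)"

lemma eventually_iterated_filter:
  "eventually P (iterated_filter F) \<longleftrightarrow> eventually (\<lambda>x. eventually (\<lambda>y. P (x, y)) F) F"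
  unfolding iterated_filter_def
proof (rule eventually_Abs_filter, rule is_filter.intro)
  fix P Q :: "'a \<times> 'a \<Rightarrow> bool"
  assume "\<forall>\<^sub>F x in F. \<forall>\<^sub>F y in F. P (x, y)" "\<forall>\<^sub>F x in F. \<forall>\<^sub>F y in F. Q (x, y)"
  then show "\<forall>\<^sub>F x in F. \<forall>\<^sub>F y in F. P (x, y) \<and> Q (x, y)"
    by eventually_elim (rule eventually_conj)
next
  fix P Q :: "'a \<times> 'a \<Rightarrow> bool"
  assume PQ: "\<forall>p. P p \<longrightarrow> Q p" and "\<forall>\<^sub>F x in F. \<forall>\<^sub>F y in F. P (x, y)"
  from this(2) show "\<forall>\<^sub>F x in F. \<forall>\<^sub>F y in F. Q (x, y)"
    by eventually_elim (erule eventually_mono, use PQ in blast)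
qed simp

text \<open>Apply the dichotomy in the outer variable to the inner statement; where the latter
  fails, the dichotomy in the inner variable gives its negation.\<close>

lemma ultrafilter_iterated:
  assumes "ultrafilter F"
  shows "ultrafilter (iterated_filter F)"
proof -
  have "eventually P (iterated_filter F) \<or> eventually (\<lambda>x. \<not> P x) (iterated_filter F)" for P
  proof (rule ultrafilter_cases[OF assms, of "\<lambda>x. eventually (\<lambda>y. P (x, y)) F"])
    assume "eventually (\<lambda>x. \<not> eventually (\<lambda>y. P (x, y)) F) F"
    then have "eventually (\<lambda>x. eventually (\<lambda>y. \<not> P (x, y)) F) F"
      by (rule eventually_mono) (metis ultrafilter_cases[OF assms])
    then show ?thesis
      unfolding eventually_iterated_filter ..
  qed (simp add: eventually_iterated_filter)
  moreover have "iterated_filter F \<noteq> bot"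
    using ultrafilter_not_bot[OF assms]
    unfolding trivial_limit_def eventually_iterated_filter by simp
  ultimately show ?thesis
    unfolding ultrafilter_def by blast
qed

lemma filterlim_fst_iterated: "filterlim fst F (iterated_filter F)"
  and filterlim_snd_iterated: "filterlim snd F (iterated_filter F)"
  by (auto simp: filterlim_iff eventually_iterated_filter elim!: eventually_mono)

section \<open>Characters of the ball algebra\<close>

lemma spectrum_one:
  assumes "\<phi> \<in> spectrum"
  shows "\<phi> 1 = 1"
proof -
  obtain f where "\<phi> f \<noteq> 0" and "\<phi> (f * 1) = \<phi> f * \<phi> 1"
    using assms unfolding spectrum_def by blast
  then show ?thesis
    by simp
qed

text \<open>Elements of \<open>Au\<close> are bounded, so this limit of point evaluations exists
  along an ultrafilter whether or not the points \<open>x i\<close> converge.\<close>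

definition limit_character ::
  "'i filter \<Rightarrow> ('i \<Rightarrow> 'a::complex_normed_vector) \<Rightarrow> 'a Au \<Rightarrow> complex" where
  "limit_character G x f = Lim G (\<lambda>i. Au_apply f (x i))"

lemma limit_character_tendsto:
  assumes "ultrafilter G"
  shows "((\<lambda>i. Au_apply f (x i)) \<longlongrightarrow> limit_character G x f) G"
proof -
  have "bounded (range (\<lambda>i. Au_apply f (x i)))"
    using Au_apply_le_norm[of f] by (auto simp: bounded_iff)
  with assms obtain l where "((\<lambda>i. Au_apply f (x i)) \<longlongrightarrow> l) G"
    by (rule ultrafilter_tendsto)
  with ultrafilter_not_bot[OF assms] show ?thesis
    unfolding limit_character_def by (metis tendsto_Lim)
qed

lemma limit_character_eqI:
  assumes "ultrafilter G" "((\<lambda>i. Au_apply f (x i)) \<longlongrightarrow> l) G"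
  shows "limit_character G x f = l"
  using assms(2) unfolding limit_character_def by (rule tendsto_Lim[OF ultrafilter_not_bot[OF assms(1)]])

text \<open>Limits respect the algebra operations. The value at \<open>1\<close> excludes the zero
  functional; there the points must lie in the ball, off which elements of \<open>Au\<close>
  vanish.\<close>

lemma limit_character_in_spectrum:
  assumes G: "ultrafilter G" and x: "\<And>i. x i \<in> ball 0 1"
  shows "limit_character G x \<in> spectrum"
proof -
  note lim = limit_character_tendsto[OF G] and eqI = limit_character_eqI[OF G]
  have "limit_character G x (f + g) = limit_character G x f + limit_character G x g" for f g
    by (rule eqI) (simp add: plus_Au.rep_eq tendsto_add lim)
  moreover have "limit_character G x (c *\<^sub>C f) = c * limit_character G x f" for c f
    by (rule eqI) (simp add: scaleC_Au.rep_eq tendsto_mult lim)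
  moreover have "limit_character G x (f * g) = limit_character G x f * limit_character G x g" for f g
    by (rule eqI) (simp add: times_Au.rep_eq tendsto_mult lim)
  moreover have "limit_character G x 1 = 1"
    by (rule eqI) (use x in \<open>simp add: one_Au.rep_eq\<close>)
  ultimately show ?thesis
    unfolding spectrum_def clinear_def by (auto intro!: exI[of _ 1])
qed

section \<open>Disc automorphisms and characters at distance 2\<close>

lemma cmod_moebius_le_1:
  fixes w :: complex and a :: real
  assumes a: "0 \<le> a" "a < 1" and w: "cmod w \<le> 1"
  shows "1 - a * w \<noteq> 0" and "cmod ((w - a) / (1 - a * w)) \<le> 1"
proof -
  have "cmod (a * w) \<le> a * 1"
    unfolding norm_mult using a w by (intro mult_mono) auto
  then show nz: "1 - a * w \<noteq> 0"
    using a by auto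
  have "(cmod w)\<^sup>2 \<le> 1"
    using w by (simp add: abs_square_le_1)
  moreover have "a\<^sup>2 \<le> 1"
    using a by (simp add: abs_square_le_1)
  ultimately have "0 \<le> (1 - (cmod w)\<^sup>2) * (1 - a\<^sup>2)"
    by simp
  \<comment> \<open>The defect identity of the disc automorphism; its nonnegative left side gives
    the bound on the modulus.\<close>
  also have "\<dots> = (cmod (1 - a * w))\<^sup>2 - (cmod (w - a))\<^sup>2"
    unfolding cmod_power2 by (simp add: power2_eq_square algebra_simps)
  finally have "cmod (w - a) \<le> cmod (1 - a * w)"
    by (simp add: power2_le_iff_abs_le)
  then show "cmod ((w - a) / (1 - a * w)) \<le> 1"
    using nz by (simp add: norm_divide)
qed

text \<open>\<open>f\<close> is \<open>g\<close> followed by a disc automorphism. The denominator is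
  multiplied out so that the conclusion is an identity in the algebra, to which characters can be
  applied.\<close>

lemma ex_Au_moebius:
  fixes g :: "'a::complex_normed_vector Au" and a :: real
  assumes a: "0 \<le> a" "a < 1" and g: "norm g \<le> 1"
  obtains f where "norm f \<le> 1" "f * (1 - complex_of_real a *\<^sub>C g) = g - complex_of_real a *\<^sub>C 1"
proof -
  define h where "h w = (w - complex_of_real a) / (1 - a * w)" for w :: complex
  have g1: "cmod (Au_apply g x) \<le> 1" for x
    using Au_apply_le_norm[of g x] g by linarith
  note nz = cmod_moebius_le_1(1)[OF a] and h1 = cmod_moebius_le_1(2)[OF a, folded h_def]
  have uc: "uniformly_continuous_on (ball 0 1) (\<lambda>x. h (Au_apply g x))"
  proof -
    \<comment> \<open>The denominator has no zero on the closed disc, whose compactness makes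
      \<open>h\<close> uniformly continuous; \<open>g\<close> takes its values there.\<close>
    have "continuous_on (cball 0 1) h"
      unfolding h_def using nz by (intro continuous_intros) auto
    then have "uniformly_continuous_on (cball 0 1) h"
      by (rule compact_uniformly_continuous) simp
    moreover have "Au_apply g ` ball 0 1 \<subseteq> cball 0 1"
      using g1 by auto
    ultimately have "uniformly_continuous_on (Au_apply g ` ball 0 1) h"
      using \<open>Au_apply g ` ball 0 1 \<subseteq> cball 0 1\<close>
      unfolding uniformly_continuous_on_def by (meson subsetD)
    moreover have "uniformly_continuous_on (ball 0 1) (Au_apply g)"
      using Au_apply[of g] by simp
    ultimately show ?thesis
      using uniformly_continuous_on_compose[of "ball 0 1" "Au_apply g" h] by (simp add: o_def)
  qed
  have hol: "fholomorphic_on (\<lambda>x. h (Au_apply g x)) (ball 0 1)"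
  proof (rule fholomorphic_onI)
    fix x :: 'a
    assume x: "x \<in> ball 0 1"
    have "fholomorphic_on (Au_apply g) (ball 0 1)"
      using Au_apply[of g] by simp
    then obtain D where D: "clinear D" "(Au_apply g has_derivative D) (at x)"
      using x by (rule fholomorphic_onE)
    have "h field_differentiable at (Au_apply g x)"
      unfolding h_def using nz[OF g1]
      by (intro field_differentiable_divide field_differentiable_diff field_differentiable_mult
          field_differentiable_const field_differentiable_ident) auto
    then obtain h' where "(h has_field_derivative h') (at (Au_apply g x))"
      unfolding field_differentiable_def ..
    then have "((\<lambda>x. h (Au_apply g x)) has_derivative (\<lambda>v. h' * D v)) (at x)"
      using has_derivative_compose[OF D(2), of h "(*) h'"] by (simp add: has_field_derivative_def)
    moreover have "clinear (\<lambda>v. h' * D v)"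
      using D(1) by (rule clinear_scale)
    ultimately show "\<exists>D. clinear D \<and> ((\<lambda>x. h (Au_apply g x)) has_derivative D) (at x)"
      by blast
  qed
  define f where "f = Au (\<lambda>x. if x \<in> ball 0 1 then h (Au_apply g x) else 0)"
  have f: "Au_apply f = (\<lambda>x. if x \<in> ball 0 1 then h (Au_apply g x) else 0)"
    unfolding f_def
  proof (intro Au_inverse CollectI conjI)
    show "uniformly_continuous_on (ball 0 1) (\<lambda>x. if x \<in> ball 0 1 then h (Au_apply g x) else 0)"
      by (rule uniformly_continuous_on_transform[OF _ uc]) simp
    show "fholomorphic_on (\<lambda>x. if x \<in> ball 0 1 then h (Au_apply g x) else 0) (ball 0 1)"
      by (rule fholomorphic_on_cong[OF open_ball _ hol]) simp
  qed simp
  show thesis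
  proof
    show "norm f \<le> 1"
      by (rule norm_Au_le) (simp add: f h1 g1)
    show "f * (1 - complex_of_real a *\<^sub>C g) = g - complex_of_real a *\<^sub>C 1"
      by (rule Au_eqI) (use nz[OF g1] in \<open>simp add: Au_rep_eqs f h_def Au_off_ball\<close>)
  qed
qed

lemma spectrum_moebius:
  fixes \<phi> :: "'a::complex_normed_vector Au \<Rightarrow> complex" and a :: real
  assumes \<phi>: "\<phi> \<in> spectrum" and a: "0 \<le> a" "a < 1"
    and f: "f * (1 - complex_of_real a *\<^sub>C g) = g - complex_of_real a *\<^sub>C 1"
  shows "\<phi> f = (\<phi> g - a) / (1 - a * \<phi> g)"
proof -
  have lin: "\<phi> (u + v) = \<phi> u + \<phi> v" "\<phi> (c *\<^sub>C u) = c * \<phi> u" "\<phi> (u * v) = \<phi> u * \<phi> v" for u v c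
    using \<phi> unfolding spectrum_def clinear_def by blast+
  have diff: "\<phi> (u - v) = \<phi> u - \<phi> v" for u v
    using lin(1)[of "u - v" v] by simp
  have eq: "\<phi> f * (1 - a * \<phi> g) = \<phi> g - a"
    using arg_cong[OF f, of \<phi>] by (simp add: lin diff spectrum_one[OF \<phi>])
  \<comment> \<open>A zero denominator would make the numerator vanish too, whence
    \<open>a * a = 1\<close>, against \<open>0 \<le> a\<close> and \<open>a < 1\<close>.\<close>
  have "1 - a * \<phi> g \<noteq> 0"
  proof
    assume 0: "1 - a * \<phi> g = 0"
    then have "\<phi> g = a"
      using eq by simp
    with 0 have "complex_of_real (a * a) = complex_of_real 1"
      by simp
    then have "a * a = 1"
      by (simp only: of_real_eq_iff)
    moreover have "a * a \<le> a * 1"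
      using a by (intro mult_left_mono) auto
    ultimately show False
      using a by simp
  qed
  then show ?thesis
    using eq by (simp add: field_simps)
qed

lemma functional_dist_ge:
  "norm f \<le> 1 \<Longrightarrow> ereal (cmod (\<phi> f - \<psi> f)) \<le> functional_dist \<phi> \<psi>"
  unfolding functional_dist_def by (rule SUP_upper) simp

text \<open>
  Compose \<open>g N\<close> with the disc automorphism \<open>w \<mapsto> (w - a) / (1 - a w)\<close>, which fixes \<open>1\<close> and, as
  \<open>a\<close> tends to \<open>1\<close>, pushes every other point of the closed disc to \<open>-1\<close>.
\<close>

lemma functional_dist_ge_2:
  fixes g :: "nat \<Rightarrow> 'a::complex_normed_vector Au"
  assumes \<phi>: "\<phi> \<in> spectrum" and \<psi>: "\<psi> \<in> spectrum" and g: "\<And>N. norm (g N) \<le> 1"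
    and \<phi>1: "(\<lambda>N. \<phi> (g N)) \<longlonglongrightarrow> 1" and \<psi>w: "(\<lambda>N. \<psi> (g N)) \<longlonglongrightarrow> w"
    and w: "cmod w \<le> 1" "w \<noteq> 1"
  shows "functional_dist \<phi> \<psi> \<ge> 2"
proof -
  \<comment> \<open>For fixed \<open>a\<close>, transform every \<open>g N\<close> and let
    \<open>N\<close> grow: the values at \<open>\<phi>\<close> tend to the fixed point 1, those at
    \<open>\<psi>\<close> to the image of \<open>w\<close>.\<close>
  have *: "ereal (cmod (1 - (w - a) / (1 - a * w))) \<le> functional_dist \<phi> \<psi>"
    if a: "0 \<le> a" "a < 1" for a :: real
  proof -
    have "\<exists>f. norm f \<le> 1 \<and> f * (1 - complex_of_real a *\<^sub>C g N) = g N - complex_of_real a *\<^sub>C 1" for N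
      by (rule ex_Au_moebius[OF a g]) blast
    then obtain f where f: "\<And>N. norm (f N) \<le> 1"
      "\<And>N. f N * (1 - complex_of_real a *\<^sub>C g N) = g N - complex_of_real a *\<^sub>C 1"
      by metis
    have "1 - complex_of_real a * 1 \<noteq> 0" "1 - complex_of_real a * w \<noteq> 0"
      using a w by (intro cmod_moebius_le_1; simp)+
    then have "(\<lambda>N. cmod ((\<phi> (g N) - a) / (1 - a * \<phi> (g N)) - (\<psi> (g N) - a) / (1 - a * \<psi> (g N))))
        \<longlonglongrightarrow> cmod ((1 - complex_of_real a) / (1 - complex_of_real a * 1) - (w - a) / (1 - a * w))"
      by (intro tendsto_intros \<phi>1 \<psi>w)
    moreover have "(1 - complex_of_real a) / (1 - complex_of_real a * 1) = 1"
      using \<open>1 - complex_of_real a * 1 \<noteq> 0\<close> by simp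
    ultimately have "(\<lambda>N. cmod (\<phi> (f N) - \<psi> (f N))) \<longlonglongrightarrow> cmod (1 - (w - a) / (1 - a * w))"
      using spectrum_moebius[OF \<phi> a f(2)] spectrum_moebius[OF \<psi> a f(2)] by simp
    then have "(\<lambda>N. ereal (cmod (\<phi> (f N) - \<psi> (f N)))) \<longlonglongrightarrow> ereal (cmod (1 - (w - a) / (1 - a * w)))"
      by simp
    then show ?thesis
      by (rule LIMSEQ_le_const2) (use functional_dist_ge[OF f(1)] in blast)
  qed
  \<comment> \<open>Parameters tending to 1 from below. As \<open>w \<noteq> 1\<close>, the image of
    \<open>w\<close> tends to \<open>(w - 1) / (1 - w) = -1\<close>, at distance 2 from 1.\<close>
  define a where "a n = 1 - inverse (real (Suc n))" for n
  have a: "0 \<le> a n" "a n < 1" for n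
    by (auto simp: a_def field_simps)
  have lim_a: "a \<longlonglongrightarrow> 1"
    unfolding a_def using tendsto_diff[OF tendsto_const LIMSEQ_inverse_real_of_nat, of "1"] by simp
  have "(\<lambda>n. ereal (cmod (1 - (w - a n) / (1 - a n * w))))
      \<longlonglongrightarrow> ereal (cmod (1 - (w - of_real 1) / (1 - of_real 1 * w)))"
    using w by (intro tendsto_ereal tendsto_intros lim_a) auto
  moreover have "(w - 1) / (1 - w) = -1"
    using w by (simp add: divide_eq_eq)
  ultimately have "(\<lambda>n. ereal (cmod (1 - (w - a n) / (1 - a n * w)))) \<longlonglongrightarrow> ereal 2"
    by simp
  then have "ereal 2 \<le> functional_dist \<phi> \<psi>"
    by (rule LIMSEQ_le_const2) (use * a in blast)
  then show ?thesis
    by simp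
qed

text \<open>A character has distance 0 from itself, so \<open>\<psi>\<close> lies in its own part;
  at distance at least 2 it lies outside that of \<open>\<phi>\<close>.\<close>

lemma gleason_part_neq:
  assumes "\<phi> \<in> spectrum" "\<psi> \<in> spectrum" "functional_dist \<phi> \<psi> \<ge> 2"
  shows "gleason_part \<phi> \<noteq> gleason_part \<psi>"
proof -
  have "functional_dist \<psi> \<psi> \<le> 0"
    unfolding functional_dist_def by (rule SUP_least) simp
  then have "functional_dist \<psi> \<psi> < 2"
    by (rule order_le_less_trans) simp
  then have "\<psi> \<in> gleason_part \<psi>" "\<psi> \<notin> gleason_part \<phi>"
    using assms by (auto simp: gleason_part_def)
  then show ?thesis
    by blast
qed

section \<open>The dual of \<open>\<ell>\<^sub>1\<close>\<close>

lemma clinear_cdual_apply: "clinear (cdual_apply x')"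
  and bounded_linear_cdual_apply: "bounded_linear (cdual_apply x')"
  using cdual_apply[of x'] by simp_all

lemmas cdual_simps [simp] =
  bounded_linear.linear[OF bounded_linear_cdual_apply, THEN linear_add]
  bounded_linear.linear[OF bounded_linear_cdual_apply, THEN linear_diff]
  bounded_linear.linear[OF bounded_linear_cdual_apply, THEN linear_0]
  bounded_linear.linear[OF bounded_linear_cdual_apply, THEN linear_scale]
  plus_cdual.rep_eq minus_cdual.rep_eq zero_cdual.rep_eq scaleR_cdual.rep_eq scaleC_cdual.rep_eq
  canonical_embedding.rep_eq

lemma cdual_apply_scaleC [simp]: "cdual_apply x' (c *\<^sub>C x) = c * cdual_apply x' x"
  using clinear_cdual_apply[of x'] by (simp add: clinear_def)

lemma cdual_apply_le: "cmod (cdual_apply x' x) \<le> norm x' * norm x"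
  unfolding norm_cdual.rep_eq by (rule onorm[OF bounded_linear_cdual_apply])

lemma norm_cdual_le:
  "0 \<le> C \<Longrightarrow> (\<And>x. cmod (cdual_apply x' x) \<le> C * norm x) \<Longrightarrow> norm x' \<le> C"
  unfolding norm_cdual.rep_eq by (rule onorm_bound)

section \<open>Coordinates in ell_1, and its dual as bounded sequences\<close>

lemma summable_ell1: "summable (\<lambda>n. cmod (ell1_coord x n))"
  using ell1_coord[of x] by simp

lemma cmod_ell1_coord_le: "cmod (ell1_coord x n) \<le> norm x"
  unfolding norm_ell1.rep_eq
  using sum_le_suminf[OF summable_ell1, of "{n}" x] by simp

lemma ell1_eqI: "(\<And>n. ell1_coord x n = ell1_coord y n) \<Longrightarrow> x = y"
  by (simp add: ell1_coord_inject[symmetric] fun_eq_iff)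

lemma norm_unit_vector [simp]: "norm (unit_vector n) = 1"
proof -
  have "(\<lambda>j. cmod (ell1_coord (unit_vector n) j)) = (\<lambda>j. if j = n then 1 else 0)"
    by (auto simp: unit_vector.rep_eq)
  then show ?thesis
    unfolding norm_ell1.rep_eq using sums_unique[OF sums_single[of n "\<lambda>_. 1::real"]] by simp
qed

text \<open>The error of a partial sum has as its norm a tail of the convergent series of
  moduli.\<close>

lemma ell1_sums: "(\<lambda>n. ell1_coord x n *\<^sub>C unit_vector n) sums x"
proof -
  let ?p = "\<lambda>n. \<Sum>k<n. ell1_coord x k *\<^sub>C unit_vector k"
  have coord: "ell1_coord (?p n) j = (if j < n then ell1_coord x j else 0)" for n j
    by (induction n)
      (auto simp: zero_ell1.rep_eq plus_ell1.rep_eq scaleC_ell1.rep_eq unit_vector.rep_eq less_Suc_eq)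
  have "norm (?p n - x) = (\<Sum>j. cmod (ell1_coord x j)) - (\<Sum>j<n. cmod (ell1_coord x j))" for n
  proof -
    have "(\<lambda>j. if j < n then cmod (ell1_coord x j) else 0) sums (\<Sum>j<n. cmod (ell1_coord x j))"
      using sums_If_finite_set[of "{..<n}" "\<lambda>j. cmod (ell1_coord x j)"] by simp
    from sums_diff[OF summable_sums[OF summable_ell1] this]
    have "(\<lambda>j. cmod (ell1_coord x j) - (if j < n then cmod (ell1_coord x j) else 0)) sums
        ((\<Sum>j. cmod (ell1_coord x j)) - (\<Sum>j<n. cmod (ell1_coord x j)))" .
    moreover have "(\<lambda>j. cmod (ell1_coord x j) - (if j < n then cmod (ell1_coord x j) else 0)) =
        (\<lambda>j. cmod (ell1_coord (?p n - x) j))"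
      by (auto simp: minus_ell1.rep_eq coord)
    ultimately show ?thesis
      unfolding norm_ell1.rep_eq by (simp add: sums_iff)
  qed
  moreover have "(\<lambda>n. (\<Sum>j. cmod (ell1_coord x j)) - (\<Sum>j<n. cmod (ell1_coord x j))) \<longlonglongrightarrow> 0"
    using tendsto_diff[OF tendsto_const[of "\<Sum>j. cmod (ell1_coord x j)"] summable_LIMSEQ[OF summable_ell1[of x]]]
    by simp
  ultimately have "(\<lambda>n. norm (?p n - x)) \<longlonglongrightarrow> 0"
    by simp
  then show ?thesis
    unfolding sums_def by (subst LIM_zero_iff[symmetric]) (rule tendsto_norm_zero_cancel)
qed

lemma cdual_apply_sums:
  "(\<lambda>n. ell1_coord x n * cdual_apply x' (unit_vector n)) sums cdual_apply x' x"
  using bounded_linear.sums[OF bounded_linear_cdual_apply[of x'] ell1_sums[of x]] by simp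

lemma ell1_cdual_eqI:
  assumes "\<And>n. cdual_apply x' (unit_vector n) = cdual_apply y' (unit_vector n)"
  shows "x' = y'"
proof -
  have "cdual_apply x' x = cdual_apply y' x" for x
    using cdual_apply_sums[of x x'] cdual_apply_sums[of x y'] unfolding assms by (rule sums_unique2)
  then show ?thesis
    by (simp add: cdual_apply_inject[symmetric] fun_eq_iff)
qed

lemma ell1_cdual_apply_le:
  assumes "\<And>n. cmod (cdual_apply x' (unit_vector n)) \<le> C"
  shows "cmod (cdual_apply x' x) \<le> C * norm x"
proof -
  have le: "cmod (ell1_coord x n * cdual_apply x' (unit_vector n)) \<le> C * cmod (ell1_coord x n)" for n
    using mult_left_mono[OF assms[of n] norm_ge_zero[of "ell1_coord x n"]]
    by (simp add: norm_mult mult.commute)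
  have sC: "summable (\<lambda>n. C * cmod (ell1_coord x n))"
    by (intro summable_mult summable_ell1)
  have s: "summable (\<lambda>n. cmod (ell1_coord x n * cdual_apply x' (unit_vector n)))"
    by (rule summable_comparison_test'[OF sC, of 0]) (simp add: le)
  have "cdual_apply x' x = (\<Sum>n. ell1_coord x n * cdual_apply x' (unit_vector n))"
    using cdual_apply_sums by (rule sums_unique)
  also have "cmod \<dots> \<le> (\<Sum>n. cmod (ell1_coord x n * cdual_apply x' (unit_vector n)))"
    by (rule summable_norm[OF s])
  also have "\<dots> \<le> (\<Sum>n. C * cmod (ell1_coord x n))"
    by (rule suminf_le[OF le s sC])
  also have "\<dots> = C * norm x"
    unfolding norm_ell1.rep_eq by (rule suminf_mult[OF summable_ell1])
  finally show ?thesis .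
qed

text \<open>Together with the reverse bound \<open>cdual_unit_vector_le\<close>, this makes the norm
  of a functional the supremum norm of its sequence.\<close>

lemma ell1_norm_cdual_le:
  assumes "\<And>n. cmod (cdual_apply x' (unit_vector n)) \<le> C"
  shows "norm x' \<le> C"
  using order_trans[OF norm_ge_zero assms] ell1_cdual_apply_le[OF assms] by (rule norm_cdual_le)

lemma cdual_unit_vector_le: "cmod (cdual_apply x' (unit_vector n)) \<le> norm x'"
  using cdual_apply_le[of x' "unit_vector n"] by simp

text \<open>The passage from bounded sequences back to functionals; sending unbounded sequences to 0
  makes the map total.\<close>

lift_definition seq_functional :: "(nat \<Rightarrow> complex) \<Rightarrow> ell1 cdual"
  is "\<lambda>u x. if bounded (range u) then \<Sum>n. ell1_coord x n * u n else 0"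
proof (cases)
  fix u :: "nat \<Rightarrow> complex"
  assume b: "bounded (range u)"
  then obtain C where C: "cmod (u n) \<le> C" for n
    by (auto simp: bounded_iff)
  have le: "cmod (ell1_coord x n * u n) \<le> C * cmod (ell1_coord x n)" for x n
    using mult_left_mono[OF C[of n] norm_ge_zero[of "ell1_coord x n"]]
    by (simp add: norm_mult mult.commute)
  have sC: "summable (\<lambda>n. C * cmod (ell1_coord x n))" for x
    by (intro summable_mult summable_ell1)
  have sn: "summable (\<lambda>n. cmod (ell1_coord x n * u n))" for x
    by (rule summable_comparison_test'[OF sC[of x], of 0]) (simp add: le)
  note s = summable_norm_cancel[OF sn]
  have add: "(\<Sum>n. ell1_coord (x + y) n * u n) = (\<Sum>n. ell1_coord x n * u n) + (\<Sum>n. ell1_coord y n * u n)" for x y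
    using suminf_add[OF s[of x] s[of y]] by (simp add: plus_ell1.rep_eq algebra_simps)
  have scale: "(\<Sum>n. ell1_coord (c *\<^sub>C x) n * u n) = c * (\<Sum>n. ell1_coord x n * u n)" for c x
    using suminf_mult[OF s[of x], of c] by (simp add: scaleC_ell1.rep_eq mult.assoc)
  have bound: "cmod (\<Sum>n. ell1_coord x n * u n) \<le> norm x * C" for x
  proof -
    have "cmod (\<Sum>n. ell1_coord x n * u n) \<le> (\<Sum>n. cmod (ell1_coord x n * u n))"
      by (rule summable_norm[OF sn])
    also have "\<dots> \<le> (\<Sum>n. C * cmod (ell1_coord x n))"
      by (rule suminf_le[OF le sn sC])
    also have "\<dots> = norm x * C"
      unfolding norm_ell1.rep_eq using suminf_mult[OF summable_ell1, of C x] by simp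
    finally show ?thesis .
  qed
  have "bounded_linear (\<lambda>x. \<Sum>n. ell1_coord x n * u n)"
    using add scale bound
    by (intro bounded_linear_intro[of _ C]) (simp_all add: scaleR_conv_of_real flip: scaleC_of_real)
  then show "clinear (\<lambda>x. if bounded (range u) then \<Sum>n. ell1_coord x n * u n else 0) \<and>
      bounded_linear (\<lambda>x. if bounded (range u) then \<Sum>n. ell1_coord x n * u n else 0)"
    using b add scale by (simp add: clinear_def)
qed (simp add: clinear_zero)

lemma seq_functional_unit_vector:
  assumes "bounded (range u)"
  shows "cdual_apply (seq_functional u) (unit_vector n) = u n"
proof -
  have "(\<lambda>j. ell1_coord (unit_vector n) j * u j) = (\<lambda>j. if j = n then u j else 0)"
    by (auto simp: unit_vector.rep_eq)
  then show ?thesis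
    using assms sums_unique[OF sums_single[of n u]] by (simp add: seq_functional.rep_eq)
qed

section \<open>Coordinatewise products and diagonal quadratic polynomials\<close>

lift_definition ell1_mult :: "ell1 \<Rightarrow> ell1 \<Rightarrow> ell1" is "\<lambda>x y n. x n * y n"
proof -
  fix x y :: "nat \<Rightarrow> complex"
  assume x: "summable (\<lambda>n. cmod (x n))" and y: "summable (\<lambda>n. cmod (y n))"
  have "cmod (x n) \<le> (\<Sum>n. cmod (x n))" for n
    using sum_le_suminf[OF x, of "{n}"] by simp
  then show "summable (\<lambda>n. cmod (x n * y n))"
    by (intro summable_comparison_test'[OF summable_mult[OF y, of "\<Sum>n. cmod (x n)"], of 0]) (simp add: norm_mult mult_right_mono)
qed

lemma norm_ell1_mult: "norm (ell1_mult x y) \<le> norm x * norm y"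
proof -
  have "norm (ell1_mult x y) \<le> (\<Sum>n. norm x * cmod (ell1_coord y n))"
    unfolding norm_ell1.rep_eq[of "ell1_mult x y"]
    by (intro suminf_le summable_ell1 summable_mult)
      (simp add: ell1_mult.rep_eq norm_mult mult_right_mono cmod_ell1_coord_le)
  then show ?thesis
    by (simp add: suminf_mult[OF summable_ell1] norm_ell1.rep_eq[of y])
qed

lemma bounded_bilinear_ell1_mult: "bounded_bilinear ell1_mult"
proof
  show "\<exists>K. \<forall>x y. norm (ell1_mult x y) \<le> norm x * norm y * K"
    using norm_ell1_mult by (intro exI[of _ 1]) simp
qed (rule ell1_eqI; simp add: ell1_mult.rep_eq plus_ell1.rep_eq scaleR_ell1.rep_eq algebra_simps)+

text \<open>The diagonal 2-homogeneous polynomial with the coefficients of \<open>d\<close>. It is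
  Lipschitz on the ball, and the product rule for \<open>ell1_mult\<close> supplies the
  derivative.\<close>

lift_definition Au_square_of_cdual :: "ell1 cdual \<Rightarrow> ell1 Au"
  is "\<lambda>d x. if x \<in> ball 0 1 then cdual_apply d (ell1_mult x x) else 0"
proof (intro conjI)
  fix d :: "ell1 cdual"
  let ?D = "\<lambda>x. cdual_apply d (ell1_mult x x)"
  interpret bounded_bilinear ell1_mult
    by (rule bounded_bilinear_ell1_mult)
  have "(2 * norm d)-lipschitz_on (ball 0 1) ?D"
  proof (rule lipschitz_onI)
    fix x y :: ell1
    assume xy: "x \<in> ball 0 1" "y \<in> ball 0 1"
    have "ell1_mult x x - ell1_mult y y = ell1_mult (x - y) x + ell1_mult y (x - y)"
      by (simp add: diff_left diff_right)
    also have "norm \<dots> \<le> norm (x - y) * norm x + norm y * norm (x - y)"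
      by (intro norm_triangle_le add_mono norm_ell1_mult)
    also have "\<dots> \<le> norm (x - y) * 1 + 1 * norm (x - y)"
      using xy by (intro add_mono mult_mono) auto
    finally have "norm (ell1_mult x x - ell1_mult y y) \<le> 2 * norm (x - y)"
      by simp
    then have "norm d * norm (ell1_mult x x - ell1_mult y y) \<le> norm d * (2 * norm (x - y))"
      by (rule mult_left_mono) simp
    moreover have "dist (?D x) (?D y) \<le> norm d * norm (ell1_mult x x - ell1_mult y y)"
      using cdual_apply_le[of d "ell1_mult x x - ell1_mult y y"] by (simp add: dist_norm)
    ultimately show "dist (?D x) (?D y) \<le> 2 * norm d * dist x y"
      by (simp add: dist_norm)
  qed simp
  then have "uniformly_continuous_on (ball 0 1) ?D"
    by (rule lipschitz_on_uniformly_continuous)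
  then show "uniformly_continuous_on (ball 0 1) (\<lambda>x. if x \<in> ball 0 1 then ?D x else 0)"
    by (rule uniformly_continuous_on_transform[rotated]) simp
  have "fholomorphic_on ?D (ball 0 1)"
  proof (rule fholomorphic_onI)
    fix x :: ell1
    have "clinear (\<lambda>h. cdual_apply d (ell1_mult x h + ell1_mult h x))"
    proof -
      have "ell1_mult x (c *\<^sub>C h) + ell1_mult (c *\<^sub>C h) x = c *\<^sub>C (ell1_mult x h + ell1_mult h x)" for c h
        by (rule ell1_eqI) (simp add: ell1_mult.rep_eq scaleC_ell1.rep_eq plus_ell1.rep_eq algebra_simps)
      then have "cdual_apply d (ell1_mult x (c *\<^sub>C h) + ell1_mult (c *\<^sub>C h) x) =
          c * cdual_apply d (ell1_mult x h + ell1_mult h x)" for c h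
        by (simp only: cdual_apply_scaleC)
      then show ?thesis
        unfolding clinear_def by (simp add: add_left add_right)
    qed
    moreover have "(?D has_derivative (\<lambda>h. cdual_apply d (ell1_mult x h + ell1_mult h x))) (at x)"
      by (rule bounded_linear.has_derivative[OF bounded_linear_cdual_apply])
        (rule FDERIV[OF has_derivative_ident has_derivative_ident])
    ultimately show "\<exists>D. clinear D \<and> (?D has_derivative D) (at x)"
      by blast
  qed
  then show "fholomorphic_on (\<lambda>x. if x \<in> ball 0 1 then ?D x else 0) (ball 0 1)"
    by (rule fholomorphic_on_cong[OF open_ball, rotated]) simp
qed simp

section \<open>Extreme points of the ball of the annihilator of \<open>c\<^sub>0\<close>\<close>

text \<open>On bounded sequences this is multiplication by the indicator of
  \<open>A\<close>.\<close>

definition cdual_restrict :: "nat set \<Rightarrow> ell1 cdual \<Rightarrow> ell1 cdual" where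
  "cdual_restrict A x' = seq_functional (\<lambda>n. if n \<in> A then cdual_apply x' (unit_vector n) else 0)"

lemma cdual_restrict_unit_vector [simp]:
  "cdual_apply (cdual_restrict A x') (unit_vector n) = (if n \<in> A then cdual_apply x' (unit_vector n) else 0)"
proof -
  have "bounded (range (\<lambda>n. if n \<in> A then cdual_apply x' (unit_vector n) else 0))"
    using cdual_unit_vector_le[of x'] by (auto simp: bounded_iff intro!: exI[of _ "norm x'"])
  then show ?thesis
    by (simp add: cdual_restrict_def seq_functional_unit_vector)
qed

lemma cdual_restrict_add: "cdual_restrict A (x' + y') = cdual_restrict A x' + cdual_restrict A y'"
  and cdual_restrict_scaleC: "cdual_restrict A (c *\<^sub>C x') = c *\<^sub>C cdual_restrict A x'"
  and cdual_restrict_scaleR: "cdual_restrict A (r *\<^sub>R x') = r *\<^sub>R cdual_restrict A x'"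
  and cdual_restrict_restrict: "cdual_restrict A (cdual_restrict B x') = cdual_restrict (A \<inter> B) x'"
  and cdual_restrict_empty: "cdual_restrict {} x' = 0"
  and cdual_restrict_UNIV: "cdual_restrict UNIV x' = x'"
  and cdual_restrict_split: "cdual_restrict A x' + cdual_restrict (- A) x' = x'"
  by (rule ell1_cdual_eqI; simp)+

text \<open>The two pieces have disjoint supports, so the supremum norm of their sum is the larger
  of their norms.\<close>

lemma norm_cdual_restrict_add_le:
  assumes "norm x' \<le> C" "norm y' \<le> C"
  shows "norm (cdual_restrict A x' + cdual_restrict (- A) y') \<le> C"
  using order_trans[OF cdual_unit_vector_le assms(1)] order_trans[OF cdual_unit_vector_le assms(2)]
  by (intro ell1_norm_cdual_le) simp

lemma norm_cdual_restrict_le: "norm (cdual_restrict A x') \<le> norm x'"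
  using cdual_unit_vector_le[of x'] by (intro ell1_norm_cdual_le) simp

text \<open>The adjoint of \<open>cdual_restrict\<close>: with \<omega> viewed as a finitely
  additive measure, its restriction to \<open>A\<close>.\<close>

lift_definition bidual_restrict :: "nat set \<Rightarrow> ell1 cdual cdual \<Rightarrow> ell1 cdual cdual"
  is "\<lambda>A \<omega> x'. \<omega> (cdual_restrict A x')"
proof (elim conjE, intro conjI)
  fix A and \<omega> :: "ell1 cdual \<Rightarrow> complex"
  assume \<omega>: "clinear \<omega>" "bounded_linear \<omega>"
  then show "clinear (\<lambda>x'. \<omega> (cdual_restrict A x'))"
    by (simp add: clinear_def cdual_restrict_add cdual_restrict_scaleC)
  have "bounded_linear (cdual_restrict A)"
    by (rule bounded_linear_intro[of _ 1])
      (simp_all add: cdual_restrict_add cdual_restrict_scaleR norm_cdual_restrict_le)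
  with \<omega>(2) show "bounded_linear (\<lambda>x'. \<omega> (cdual_restrict A x'))"
    by (rule bounded_linear_compose)
qed

lemma bidual_restrict_split: "bidual_restrict A \<omega> + bidual_restrict (- A) \<omega> = \<omega>"
proof -
  have "cdual_apply \<omega> (cdual_restrict A x') + cdual_apply \<omega> (cdual_restrict (- A) x') = cdual_apply \<omega> x'" for x'
    using cdual_restrict_split[of A x'] by (metis cdual_simps(1))
  then show ?thesis
    by (simp add: cdual_apply_inject[symmetric] fun_eq_iff bidual_restrict.rep_eq)
qed

lemma bidual_restrict_c0_perp:
  assumes "\<omega> \<in> c0_perp"
  shows "bidual_restrict A \<omega> \<in> c0_perp"
proof -
  have "cdual_restrict A x' \<in> c0" if "x' \<in> c0" for x'
  proof -
    have "(\<lambda>n. cdual_apply x' (unit_vector n)) \<longlonglongrightarrow> 0"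
      using that by (simp add: c0_def)
    then have "(\<lambda>n. cdual_apply (cdual_restrict A x') (unit_vector n)) \<longlonglongrightarrow> 0"
      by (rule Lim_null_comparison[rotated, OF tendsto_norm_zero]) simp
    then show ?thesis
      by (simp add: c0_def)
  qed
  with assms show ?thesis
    by (simp add: c0_perp_def bidual_restrict.rep_eq)
qed

lemma norm_cdual_le_unit_ball:
  assumes "0 \<le> C" and le: "\<And>x. norm x \<le> 1 \<Longrightarrow> cmod (cdual_apply x' x) \<le> C"
  shows "norm x' \<le> C"
proof (rule norm_cdual_le[OF assms(1)])
  fix x
  have "cmod (cdual_apply x' ((1 / norm x) *\<^sub>R x)) \<le> C"
    by (rule le) simp
  then show "cmod (cdual_apply x' x) \<le> C * norm x"
    by (cases "x = 0") (auto simp: field_simps scaleR_conv_of_real norm_divide norm_mult)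
qed

lemma cnj_sgn_mult: "cnj (sgn w) * w = cmod w"
  by (cases "w = 0") (auto simp: sgn_eq field_simps complex_norm_square[symmetric] power2_eq_square)

text \<open>Unit functionals for the two pieces can be joined along \<open>A\<close> and
  \<open>- A\<close> without increasing the supremum norm, so the moduli of both values add up to at
  most \<open>norm \<omega>\<close>.\<close>

lemma norm_bidual_restrict_add: "norm (bidual_restrict A \<omega>) + norm (bidual_restrict (- A) \<omega>) \<le> norm \<omega>"
proof -
  let ?a = "\<lambda>x'. cdual_apply (bidual_restrict A \<omega>) x'" and ?b = "\<lambda>y'. cdual_apply (bidual_restrict (- A) \<omega>) y'"
  have pair: "cmod (?a x') + cmod (?b y') \<le> norm \<omega>" if "norm x' \<le> 1" "norm y' \<le> 1" for x' y'
  proof -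
    \<comment> \<open>These factors turn both values into their moduli, so that nothing
      cancels.\<close>
    define \<alpha> \<beta> where "\<alpha> = cnj (sgn (?a x'))" and "\<beta> = cnj (sgn (?b y'))"
    define w' where "w' = cdual_restrict A (\<alpha> *\<^sub>C x') + cdual_restrict (- A) (\<beta> *\<^sub>C y')"
    have "cmod \<alpha> \<le> 1" "cmod \<beta> \<le> 1"
      by (simp_all add: \<alpha>_def \<beta>_def norm_sgn)
    then have "norm w' \<le> 1"
      using that unfolding w'_def
      by (intro norm_cdual_restrict_add_le) (simp_all add: norm_scaleC mult_le_one)
    then have "norm \<omega> * norm w' \<le> norm \<omega>"
      by (simp add: mult_left_le)
    moreover have "cdual_apply \<omega> w' = \<alpha> * ?a x' + \<beta> * ?b y'"
      by (simp add: w'_def cdual_restrict_scaleC bidual_restrict.rep_eq)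
    then have "cdual_apply \<omega> w' = of_real (cmod (?a x') + cmod (?b y'))"
      by (simp add: \<alpha>_def \<beta>_def cnj_sgn_mult)
    then have "cmod (cdual_apply \<omega> w') = cmod (?a x') + cmod (?b y')"
      by (simp only: norm_of_real) simp
    ultimately show ?thesis
      using cdual_apply_le[of \<omega> w'] by linarith
  qed
  \<comment> \<open>The suprema are taken one at a time, first over \<open>y'\<close>, then over
    \<open>x'\<close>; the choice 0 for the other functional shows that the bounds are
    nonnegative.\<close>
  have *: "norm (bidual_restrict (- A) \<omega>) \<le> norm \<omega> - cmod (?a x')" if "norm x' \<le> 1" for x'
    using pair[OF that] pair[OF that, of 0]
    by (intro norm_cdual_le_unit_ball) (auto simp: algebra_simps)
  have "norm (bidual_restrict A \<omega>) \<le> norm \<omega> - norm (bidual_restrict (- A) \<omega>)"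
    using *[of 0] by (intro norm_cdual_le_unit_ball) (use * in \<open>force simp: algebra_simps\<close>)+
  then show ?thesis
    by simp
qed

text \<open>If both pieces were nonzero, rescaling each to norm \<open>norm \<omega>\<close> would
  make \<open>\<omega>\<close> a proper convex combination, with weights summing to 1 by additivity
  of the norm. Extremality forces the rescaled pieces to coincide, though they are carried by
  complementary sets.\<close>

lemma extreme_point_bidual_restrict:
  assumes \<omega>: "\<omega> \<in> c0_perp"
    and ext: "\<omega> extreme_point_of ((\<lambda>\<eta>. norm \<omega> *\<^sub>R \<eta>) ` (cball 0 1 \<inter> c0_perp))"
  shows "bidual_restrict A \<omega> = 0 \<or> bidual_restrict (- A) \<omega> = 0"
proof (rule ccontr)
  let ?S = "(\<lambda>\<eta>. norm \<omega> *\<^sub>R \<eta>) ` (cball 0 1 \<inter> c0_perp)"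
  define a b where "a = bidual_restrict A \<omega>" and "b = bidual_restrict (- A) \<omega>"
  assume "\<not> (bidual_restrict A \<omega> = 0 \<or> bidual_restrict (- A) \<omega> = 0)"
  then have nz: "norm a > 0" "norm b > 0"
    by (auto simp: a_def b_def)
  have ab: "a + b = \<omega>"
    unfolding a_def b_def by (rule bidual_restrict_split)
  have r: "norm a + norm b = norm \<omega>"
    using norm_bidual_restrict_add[of A \<omega>] norm_triangle_ineq[of a b] ab
    by (simp add: a_def b_def)
  then have "norm \<omega> > 0"
    using nz by linarith
  have in_S: "(norm \<omega> / norm \<eta>) *\<^sub>R \<eta> \<in> ?S" if "\<eta> \<in> c0_perp" "norm \<eta> > 0" for \<eta>
  proof
    show "(norm \<omega> / norm \<eta>) *\<^sub>R \<eta> = norm \<omega> *\<^sub>R ((1 / norm \<eta>) *\<^sub>R \<eta>)"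
      by simp
    show "(1 / norm \<eta>) *\<^sub>R \<eta> \<in> cball 0 1 \<inter> c0_perp"
      using that by (simp add: c0_perp_def)
  qed
  have "a \<in> c0_perp" "b \<in> c0_perp"
    unfolding a_def b_def using \<omega> by (auto intro: bidual_restrict_c0_perp)
  then have "\<omega> \<notin> open_segment ((norm \<omega> / norm a) *\<^sub>R a) ((norm \<omega> / norm b) *\<^sub>R b)"
    using ext in_S nz unfolding extreme_point_of_def by blast
  moreover have "\<omega> = (1 - norm b / norm \<omega>) *\<^sub>R ((norm \<omega> / norm a) *\<^sub>R a)
      + (norm b / norm \<omega>) *\<^sub>R ((norm \<omega> / norm b) *\<^sub>R b)"
  proof -
    have "1 - norm b / norm \<omega> = norm a / norm \<omega>"
      using r \<open>norm \<omega> > 0\<close> by (simp add: field_simps)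
    then show ?thesis
      using ab nz \<open>norm \<omega> > 0\<close> by simp
  qed
  moreover have "norm b < norm \<omega>"
    using r nz by linarith
  then have "0 < norm b / norm \<omega>" "norm b / norm \<omega> < 1"
    using nz \<open>norm \<omega> > 0\<close> by simp_all
  ultimately have eq: "(norm \<omega> / norm a) *\<^sub>R a = (norm \<omega> / norm b) *\<^sub>R b"
    unfolding in_segment by blast
  \<comment> \<open>On functionals supported in \<open>A\<close> the equality kills
    \<open>b\<close>, hence \<open>a\<close>, which sees nothing else.\<close>
  have "cdual_apply a x' = 0" for x'
  proof -
    have "cdual_apply b (cdual_restrict A x') = 0"
      by (simp add: b_def bidual_restrict.rep_eq cdual_restrict_restrict cdual_restrict_empty)
    then have "cdual_apply ((norm \<omega> / norm b) *\<^sub>R b) (cdual_restrict A x') = 0"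
      by simp
    then have "cdual_apply ((norm \<omega> / norm a) *\<^sub>R a) (cdual_restrict A x') = 0"
      unfolding eq .
    then have "cdual_apply a (cdual_restrict A x') = 0"
      using nz \<open>norm \<omega> > 0\<close> by simp
    then show ?thesis
      by (simp add: a_def bidual_restrict.rep_eq cdual_restrict_restrict)
  qed
  then have "a = 0"
    by (simp add: cdual_apply_inject[symmetric] fun_eq_iff)
  with nz show False
    by simp
qed

text \<open>
  By the preceding dichotomy, the sets carrying \<open>\<omega>\<close> form an ultrafilter, so \<open>\<omega>\<close> is a multiple of
  the limit along it.
\<close>

lemma extreme_point_c0_perp:
  assumes \<omega>: "\<omega> \<in> c0_perp" "\<omega> \<noteq> 0"
    and ext: "\<omega> extreme_point_of ((\<lambda>\<eta>. norm \<omega> *\<^sub>R \<eta>) ` (cball 0 1 \<inter> c0_perp))"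
  obtains F c where "ultrafilter F" "F \<le> sequentially" "cmod c = norm \<omega>"
    "\<And>x' l. ((\<lambda>n. cdual_apply x' (unit_vector n)) \<longlongrightarrow> l) F \<Longrightarrow> cdual_apply \<omega> x' = c * l"
proof -
  \<comment> \<open>A predicate holds eventually when \<open>\<omega>\<close> annihilates all
    functionals supported where it fails.\<close>
  define F where "F = Abs_filter (\<lambda>P. \<forall>x'. cdual_apply \<omega> (cdual_restrict {n. \<not> P n} x') = 0)"
  have ev: "eventually P F \<longleftrightarrow> (\<forall>x'. cdual_apply \<omega> (cdual_restrict {n. \<not> P n} x') = 0)" for P
    unfolding F_def
  proof (rule eventually_Abs_filter, rule is_filter.intro)
    fix P Q :: "nat \<Rightarrow> bool"
    assume P: "\<forall>x'. cdual_apply \<omega> (cdual_restrict {n. \<not> P n} x') = 0"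
      and Q: "\<forall>x'. cdual_apply \<omega> (cdual_restrict {n. \<not> Q n} x') = 0"
    show "\<forall>x'. cdual_apply \<omega> (cdual_restrict {n. \<not> (P n \<and> Q n)} x') = 0"
    proof
      fix x'
      \<comment> \<open>The set where \<open>P \<and> Q\<close> fails is split disjointly:
        \<open>P\<close> fails, or \<open>P\<close> holds and \<open>Q\<close> fails.\<close>
      have "cdual_restrict {n. \<not> (P n \<and> Q n)} x' =
          cdual_restrict {n. \<not> P n} x' + cdual_restrict {n. \<not> Q n} (cdual_restrict {n. P n} x')"
        by (rule ell1_cdual_eqI) simp
      with P Q show "cdual_apply \<omega> (cdual_restrict {n. \<not> (P n \<and> Q n)} x') = 0"
        by simp
    qed
  next
    fix P Q :: "nat \<Rightarrow> bool"
    assume PQ: "\<forall>n. P n \<longrightarrow> Q n"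
      and P: "\<forall>x'. cdual_apply \<omega> (cdual_restrict {n. \<not> P n} x') = 0"
    have "cdual_restrict {n. \<not> Q n} x' = cdual_restrict {n. \<not> P n} (cdual_restrict {n. \<not> Q n} x')" for x'
      by (rule ell1_cdual_eqI) (use PQ in auto)
    with P show "\<forall>x'. cdual_apply \<omega> (cdual_restrict {n. \<not> Q n} x') = 0"
      by metis
  qed (simp add: cdual_restrict_empty)
  have "F \<noteq> bot"
    using \<omega>(2) by (auto simp: trivial_limit_def ev cdual_restrict_UNIV cdual_apply_inject[symmetric] fun_eq_iff)
  moreover have "eventually P F \<or> eventually (\<lambda>n. \<not> P n) F" for P
    using extreme_point_bidual_restrict[OF \<omega>(1) ext, of "{n. P n}"]
    by (auto simp: ev cdual_apply_inject[symmetric] fun_eq_iff bidual_restrict.rep_eq Collect_neg_eq)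
  ultimately have F: "ultrafilter F"
    unfolding ultrafilter_def by blast
  have seq: "F \<le> sequentially"
    unfolding le_sequentially
  proof
    fix N
    \<comment> \<open>Finitely supported sequences lie in \<open>c0\<close>; this makes the
      ultrafilter free.\<close>
    have "cdual_restrict {n. \<not> N \<le> n} x' \<in> c0" for x'
      unfolding c0_def
      by (auto intro!: tendsto_eventually eventually_sequentiallyI[of N])
    then show "eventually (\<lambda>n. N \<le> n) F"
      using \<omega>(1) by (simp add: ev c0_perp_def)
  qed
  \<comment> \<open>The factor \<open>c\<close> is read off from the constant sequence 1.\<close>
  define one where "one = seq_functional (\<lambda>n. 1)"
  have one: "cdual_apply one (unit_vector n) = 1" for n
    unfolding one_def by (rule seq_functional_unit_vector) simp
  define c where "c = cdual_apply \<omega> one"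
  \<comment> \<open>Up to a piece annihilated by \<open>\<omega>\<close>, the sequence of
    \<open>y'\<close> is bounded by any prescribed \<open>\<eta> > 0\<close>.\<close>
  have lim0: "cdual_apply \<omega> y' = 0" if y': "((\<lambda>n. cdual_apply y' (unit_vector n)) \<longlongrightarrow> 0) F" for y'
  proof -
    have "cmod (cdual_apply \<omega> y') \<le> 0 + \<epsilon>" if \<epsilon>: "0 < \<epsilon>" for \<epsilon>
    proof -
      define \<eta> where "\<eta> = \<epsilon> / norm \<omega>"
      have \<eta>: "0 < \<eta>" "norm \<omega> * \<eta> = \<epsilon>"
        using \<epsilon> \<omega>(2) by (simp_all add: \<eta>_def)
      define P where "P n \<longleftrightarrow> cmod (cdual_apply y' (unit_vector n)) < \<eta>" for n
      have "eventually P F"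
        using tendstoD[OF y' \<eta>(1)] unfolding P_def by simp
      then have "cdual_apply \<omega> (cdual_restrict (- {n. P n}) y') = 0"
        by (simp add: ev Collect_neg_eq)
      then have "cdual_apply \<omega> y' = cdual_apply \<omega> (cdual_restrict {n. P n} y')"
        using cdual_restrict_split[of "{n. P n}" y'] by (metis add.right_neutral cdual_simps(1))
      also have "cmod \<dots> \<le> norm \<omega> * norm (cdual_restrict {n. P n} y')"
        by (rule cdual_apply_le)
      also have "norm (cdual_restrict {n. P n} y') \<le> \<eta>"
        using \<eta>(1) by (intro ell1_norm_cdual_le) (simp add: P_def)
      finally show ?thesis
        using \<eta>(2) by (simp add: mult_left_mono)
    qed
    then have "cmod (cdual_apply \<omega> y') \<le> 0"
      by (rule field_le_epsilon)
    then show ?thesis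
      by simp
  qed
  have lim: "cdual_apply \<omega> x' = c * l" if "((\<lambda>n. cdual_apply x' (unit_vector n)) \<longlongrightarrow> l) F" for x' l
    using lim0[of "x' - l *\<^sub>C one"] that
    by (simp add: one c_def LIM_zero_iff algebra_simps)
  have "cmod c = norm \<omega>"
  proof (rule antisym)
    have "norm one \<le> 1"
      by (rule ell1_norm_cdual_le) (simp add: one)
    then show "cmod c \<le> norm \<omega>"
      unfolding c_def using cdual_apply_le[of \<omega> one] mult_left_le[of "norm one" "norm \<omega>"] by simp
    show "norm \<omega> \<le> cmod c"
    proof (rule norm_cdual_le)
      fix x'
      have "bounded (range (\<lambda>n. cdual_apply x' (unit_vector n)))"
        using cdual_unit_vector_le[of x'] by (auto simp: bounded_iff)
      with F obtain l where l: "((\<lambda>n. cdual_apply x' (unit_vector n)) \<longlongrightarrow> l) F"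
        by (rule ultrafilter_tendsto)
      have "cmod l \<le> norm x'"
        by (rule tendsto_upperbound[OF tendsto_norm[OF l] _ ultrafilter_not_bot[OF F]])
          (simp add: cdual_unit_vector_le)
      then show "cmod (cdual_apply \<omega> x') \<le> cmod c * norm x'"
        by (simp add: lim[OF l] norm_mult mult_left_mono)
    qed simp
  qed
  with F seq lim show thesis
    by (intro that)
qed

section \<open>Peaking functions\<close>

lift_definition ell1_restrict :: "nat set \<Rightarrow> ell1 \<Rightarrow> ell1" is "\<lambda>A x n. if n \<in> A then x n else 0"
proof -
  fix A :: "nat set" and x :: "nat \<Rightarrow> complex"
  assume "summable (\<lambda>n. cmod (x n))"
  then show "summable (\<lambda>n. cmod (if n \<in> A then x n else 0))"
    by (rule summable_comparison_test'[of _ 0]) simp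
qed

lemma norm_ell1_restrict: "norm (ell1_restrict A x) + norm (ell1_restrict (- A) x) = norm x"
proof -
  have "(\<Sum>n. cmod (ell1_coord (ell1_restrict A x) n) + cmod (ell1_coord (ell1_restrict (- A) x) n)) = norm x"
    unfolding norm_ell1.rep_eq[of x] by (rule suminf_cong) (simp add: ell1_restrict.rep_eq)
  then show ?thesis
    using suminf_add[OF summable_ell1[of "ell1_restrict A x"] summable_ell1[of "ell1_restrict (- A) x"]]
    by (simp add: norm_ell1.rep_eq)
qed

lemma cdual_apply_ell1_restrict:
  assumes "\<And>n. n \<notin> A \<Longrightarrow> cdual_apply x' (unit_vector n) = 0"
  shows "cdual_apply x' (ell1_restrict A x) = cdual_apply x' x"
proof (rule sums_unique2[OF cdual_apply_sums])
  have "(\<lambda>n. ell1_coord (ell1_restrict A x) n * cdual_apply x' (unit_vector n)) =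
      (\<lambda>n. ell1_coord x n * cdual_apply x' (unit_vector n))"
    using assms by (auto simp: ell1_restrict.rep_eq)
  then show "(\<lambda>n. ell1_coord (ell1_restrict A x) n * cdual_apply x' (unit_vector n)) sums cdual_apply x' x"
    by (simp add: cdual_apply_sums)
qed

lemma norm_ell1_restrict_lessThan: "norm (ell1_restrict {..<N} x) = (\<Sum>j<N. cmod (ell1_coord x j))"
proof -
  have "(\<lambda>j. cmod (ell1_coord (ell1_restrict {..<N} x) j)) = (\<lambda>j. if j \<in> {..<N} then cmod (ell1_coord x j) else 0)"
    by (auto simp: ell1_restrict.rep_eq)
  then show ?thesis
    unfolding norm_ell1.rep_eq
    using sums_unique[OF sums_If_finite_set[of "{..<N}" "\<lambda>j. cmod (ell1_coord x j)"]] by simp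
qed

lemma norm_ell1_restrict_lessThan_tendsto: "(\<lambda>N. norm (ell1_restrict {..<N} x)) \<longlonglongrightarrow> norm x"
  unfolding norm_ell1_restrict_lessThan norm_ell1.rep_eq[of x] by (rule summable_LIMSEQ[OF summable_ell1])

lemma norm_ell1_restrict_tail_tendsto: "(\<lambda>N. norm (ell1_restrict {N..} x)) \<longlonglongrightarrow> 0"
proof -
  have "norm (ell1_restrict {N..} x) = norm x - norm (ell1_restrict {..<N} x)" for N
    using norm_ell1_restrict[of "{..<N}" x] by simp
  then show ?thesis
    using tendsto_diff[OF tendsto_const[of "norm x"] norm_ell1_restrict_lessThan_tendsto[of x]] by simp
qed

text \<open>Norms the first \<open>N\<close> coordinates of \<open>z\<close>, with coefficient 0
  where a coordinate vanishes. Its support is finite, so elements of \<open>c0_perp\<close>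
  annihilate it.\<close>

definition head_functional :: "ell1 \<Rightarrow> nat \<Rightarrow> ell1 cdual" where
  "head_functional z N = seq_functional (\<lambda>j. if j < N then cnj (sgn (ell1_coord z j)) else 0)"

text \<open>Its value at a fixed vector tends to 0 as \<open>N\<close> grows, while its coefficients
  have the limit \<open>v\<close> along any free ultrafilter, whatever \<open>N\<close> is.\<close>

definition tail_functional :: "complex \<Rightarrow> nat \<Rightarrow> ell1 cdual" where
  "tail_functional v N = seq_functional (\<lambda>j. if j < N then 0 else v)"

lemma head_functional_unit_vector [simp]:
  "cdual_apply (head_functional z N) (unit_vector n) = (if n < N then cnj (sgn (ell1_coord z n)) else 0)"
  unfolding head_functional_def
  by (subst seq_functional_unit_vector) (auto simp: bounded_iff norm_sgn intro!: exI[of _ 1])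

lemma tail_functional_unit_vector [simp]:
  "cdual_apply (tail_functional v N) (unit_vector n) = (if n < N then 0 else v)"
  unfolding tail_functional_def
  by (subst seq_functional_unit_vector) (auto simp: bounded_iff intro!: exI[of _ "cmod v"])

lemma head_functional_self: "cdual_apply (head_functional z N) z = norm (ell1_restrict {..<N} z)"
proof -
  have "(\<lambda>n. ell1_coord z n * cdual_apply (head_functional z N) (unit_vector n)) =
      (\<lambda>n. if n \<in> {..<N} then complex_of_real (cmod (ell1_coord z n)) else 0)"
    using cnj_sgn_mult by (auto simp: mult.commute)
  then have "(\<lambda>n. if n \<in> {..<N} then complex_of_real (cmod (ell1_coord z n)) else 0)
      sums cdual_apply (head_functional z N) z"
    using cdual_apply_sums[of z "head_functional z N"] by simp
  then show ?thesis
    using sums_If_finite_set[of "{..<N}" "\<lambda>n. complex_of_real (cmod (ell1_coord z n))"]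
    by (simp add: sums_unique2 norm_ell1_restrict_lessThan)
qed

lemma head_functional_le: "cmod (cdual_apply (head_functional z N) x) \<le> norm (ell1_restrict {..<N} x)"
proof -
  have "cmod (cdual_apply (head_functional z N) (ell1_restrict {..<N} x)) \<le> 1 * norm (ell1_restrict {..<N} x)"
    by (rule ell1_cdual_apply_le) (simp add: norm_sgn)
  then show ?thesis
    using cdual_apply_ell1_restrict[of "{..<N}" "head_functional z N" x] by simp
qed

lemma tail_functional_le:
  assumes "cmod v \<le> 1"
  shows "cmod (cdual_apply (tail_functional v N) x) \<le> norm (ell1_restrict {N..} x)"
proof -
  have "cmod (cdual_apply (tail_functional v N) (ell1_restrict {N..} x)) \<le> 1 * norm (ell1_restrict {N..} x)"
    by (rule ell1_cdual_apply_le) (simp add: assms)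
  then show ?thesis
    using cdual_apply_ell1_restrict[of "{N..}" "tail_functional v N" x] by simp
qed

lemma tail_functional_square_le:
  assumes "cmod v \<le> 1"
  shows "cmod (cdual_apply (tail_functional v N) (ell1_mult x x)) \<le> (norm (ell1_restrict {N..} x))\<^sup>2"
proof -
  have "ell1_restrict A (ell1_mult x x) = ell1_mult (ell1_restrict A x) (ell1_restrict A x)" for A
    by (rule ell1_eqI) (simp add: ell1_restrict.rep_eq ell1_mult.rep_eq)
  then show ?thesis
    using tail_functional_le[OF assms, of N "ell1_mult x x"]
      norm_ell1_mult[of "ell1_restrict {N..} x" "ell1_restrict {N..} x"]
    by (simp add: power2_eq_square)
qed

lemma tail_functional_tendsto:
  assumes "cmod v \<le> 1"
  shows "(\<lambda>N. cdual_apply (tail_functional v N) x) \<longlonglongrightarrow> 0"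
  by (rule Lim_null_comparison[OF _ norm_ell1_restrict_tail_tendsto[of x]]) (simp add: tail_functional_le[OF assms])

lemma head_functional_tendsto: "(\<lambda>N. cdual_apply (head_functional z N) z) \<longlonglongrightarrow> norm z"
  unfolding head_functional_self by (intro tendsto_of_real norm_ell1_restrict_lessThan_tendsto)

text \<open>Head plus tail is a functional of norm at most 1. As \<open>N\<close> grows it sees all
  of \<open>norm z\<close> through the head, and \<open>r\<close> through \<omega>.\<close>

lemma norm_add_le_head_tail:
  assumes v: "cmod v = 1" and \<omega>: "\<And>N. cdual_apply \<omega> (head_functional z N + tail_functional v N) = complex_of_real r"
    and "0 \<le> r"
  shows "norm z + r \<le> norm (canonical_embedding z + \<omega>)"
proof -
  let ?u = "\<lambda>N. head_functional z N + tail_functional v N"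
  have "norm (?u N) \<le> 1" for N
    by (rule ell1_norm_cdual_le) (use v in \<open>simp add: norm_sgn\<close>)
  then have "norm (canonical_embedding z + \<omega>) * norm (?u N) \<le> norm (canonical_embedding z + \<omega>)" for N
    by (simp add: mult_left_le)
  then have le: "cmod (cdual_apply (canonical_embedding z + \<omega>) (?u N)) \<le> norm (canonical_embedding z + \<omega>)" for N
    using cdual_apply_le order_trans by blast
  have "cdual_apply (canonical_embedding z + \<omega>) (?u N) =
      cdual_apply (head_functional z N) z + cdual_apply (tail_functional v N) z + r" for N
    using \<omega>[of N] by simp
  moreover have "(\<lambda>N. cmod (cdual_apply (head_functional z N) z + cdual_apply (tail_functional v N) z + r))
      \<longlonglongrightarrow> cmod (complex_of_real (norm z) + 0 + r)"
    using v by (intro tendsto_intros head_functional_tendsto tail_functional_tendsto) simp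
  ultimately have "cmod (complex_of_real (norm z) + 0 + r) \<le> norm (canonical_embedding z + \<omega>)"
    using le by (intro LIMSEQ_le_const2) auto
  moreover have "cmod (complex_of_real (norm z) + 0 + r) = norm z + r"
    using \<open>0 \<le> r\<close> by (simp flip: of_real_add)
  ultimately show ?thesis
    by simp
qed

text \<open>
  This is \<open>(L + T)\<^sup>2\<close>, for \<open>L\<close> the head and \<open>T\<close> the tail functional, with the off-diagonal terms of
  \<open>T\<^sup>2\<close> omitted: it still peaks when the tail of \<open>x\<close> is carried by a single coordinate, but not when
  the tail is spread over two.
\<close>

definition peak :: "ell1 \<Rightarrow> complex \<Rightarrow> nat \<Rightarrow> ell1 Au" where
  "peak z v N =
     Au_of_cdual (head_functional z N) * Au_of_cdual (head_functional z N + 2 *\<^sub>C tail_functional v N)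
     + Au_square_of_cdual (tail_functional (v\<^sup>2) N)"

text \<open>With \<open>a\<close> and \<open>b\<close> the norms of the head and tail of
  \<open>x\<close>, the bounds combine to \<open>a * (a + 2 * b) + b\<^sup>2\<close>, a perfect
  square equal to that of \<open>norm x\<close>.\<close>

lemma norm_peak_le:
  assumes v: "cmod v = 1"
  shows "norm (peak z v N) \<le> 1"
proof (rule norm_Au_le)
  fix x :: ell1
  assume x: "x \<in> ball 0 1"
  define a b where "a = norm (ell1_restrict {..<N} x)" and "b = norm (ell1_restrict {N..} x)"
  let ?L = "cdual_apply (head_functional z N) x" and ?T = "cdual_apply (tail_functional v N) x"
    and ?D = "cdual_apply (tail_functional (v\<^sup>2) N) (ell1_mult x x)"
  have ab: "a + b = norm x" "0 \<le> a" "0 \<le> b"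
    unfolding a_def b_def using norm_ell1_restrict[of "{..<N}" x] by simp_all
  have L: "cmod ?L \<le> a" and T: "cmod ?T \<le> b" and D: "cmod ?D \<le> b\<^sup>2"
    unfolding a_def b_def using v
    by (auto intro!: head_functional_le tail_functional_le tail_functional_square_le simp: norm_power)
  have "cmod (Au_apply (peak z v N) x) = cmod (?L * (?L + 2 * ?T) + ?D)"
    using x by (simp add: peak_def plus_Au.rep_eq times_Au.rep_eq Au_of_cdual.rep_eq Au_square_of_cdual.rep_eq)
  also have "\<dots> \<le> cmod ?L * (cmod ?L + 2 * cmod ?T) + cmod ?D"
    by (rule norm_triangle_le) (simp add: norm_mult mult_left_mono norm_triangle_le)
  also have "\<dots> \<le> a * (a + 2 * b) + b\<^sup>2"
    using L T D ab by (intro add_mono mult_mono) auto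
  also have "\<dots> = (norm x)\<^sup>2"
    by (simp add: power2_eq_square algebra_simps flip: ab(1))
  also have "\<dots> \<le> 1"
    using x by (simp add: abs_square_le_1)
  finally show "cmod (Au_apply (peak z v N) x) \<le> 1" .
qed

section \<open>Characters in the fiber\<close>

text \<open>The scalar factor moves points of the closed ball into the open one and tends to 1 as
  the first index grows; \<open>\<beta> = 0\<close> gives a perturbation in one coordinate.\<close>

definition perturbation :: "ell1 \<Rightarrow> complex \<Rightarrow> complex \<Rightarrow> nat \<times> nat \<Rightarrow> ell1" where
  "perturbation z \<alpha> \<beta> p =
     (1 - inverse (real (Suc (fst p)))) *\<^sub>R (z + \<alpha> *\<^sub>C unit_vector (fst p) + \<beta> *\<^sub>C unit_vector (snd p))"

lemma perturbation_in_ball: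
  assumes "norm z + cmod \<alpha> + cmod \<beta> \<le> 1"
  shows "perturbation z \<alpha> \<beta> p \<in> ball 0 1"
proof -
  let ?y = "z + \<alpha> *\<^sub>C unit_vector (fst p) + \<beta> *\<^sub>C unit_vector (snd p)"
  have "norm ?y \<le> norm z + cmod \<alpha> + cmod \<beta>"
    by (intro norm_triangle_le add_mono) (simp_all add: norm_scaleC)
  then have "norm ?y \<le> 1"
    using assms by linarith
  moreover have "0 \<le> 1 - inverse (real (Suc (fst p)))" "1 - inverse (real (Suc (fst p))) < 1"
    by (simp_all add: field_simps)
  ultimately have "(1 - inverse (real (Suc (fst p)))) * norm ?y < 1"
    by (meson le_less_trans mult_left_le)
  then show ?thesis
    using \<open>0 \<le> 1 - inverse (real (Suc (fst p)))\<close> by (simp add: perturbation_def)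
qed

text \<open>Distinct unit vectors have coordinatewise product 0, so no term in
  \<open>\<alpha> * \<beta>\<close> arises.\<close>

lemma perturbation_square:
  assumes "fst p \<noteq> snd p"
  shows "ell1_mult (perturbation z \<alpha> \<beta> p) (perturbation z \<alpha> \<beta> p) =
    complex_of_real ((1 - inverse (real (Suc (fst p))))\<^sup>2) *\<^sub>C
      (ell1_mult z z + (2 * \<alpha> * ell1_coord z (fst p) + \<alpha>\<^sup>2) *\<^sub>C unit_vector (fst p)
        + (2 * \<beta> * ell1_coord z (snd p) + \<beta>\<^sup>2) *\<^sub>C unit_vector (snd p))"
proof -
  have "ell1_mult (s *\<^sub>R (z + \<alpha> *\<^sub>C unit_vector m + \<beta> *\<^sub>C unit_vector n)) (s *\<^sub>R (z + \<alpha> *\<^sub>C unit_vector m + \<beta> *\<^sub>C unit_vector n)) =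
    complex_of_real (s\<^sup>2) *\<^sub>C (ell1_mult z z + (2 * \<alpha> * ell1_coord z m + \<alpha>\<^sup>2) *\<^sub>C unit_vector m
        + (2 * \<beta> * ell1_coord z n + \<beta>\<^sup>2) *\<^sub>C unit_vector n)" if "m \<noteq> n" for s m n
  proof (rule ell1_eqI)
    fix k
    show "ell1_coord (ell1_mult (s *\<^sub>R (z + \<alpha> *\<^sub>C unit_vector m + \<beta> *\<^sub>C unit_vector n))
          (s *\<^sub>R (z + \<alpha> *\<^sub>C unit_vector m + \<beta> *\<^sub>C unit_vector n))) k =
        ell1_coord (complex_of_real (s\<^sup>2) *\<^sub>C (ell1_mult z z + (2 * \<alpha> * ell1_coord z m + \<alpha>\<^sup>2) *\<^sub>C unit_vector m
          + (2 * \<beta> * ell1_coord z n + \<beta>\<^sup>2) *\<^sub>C unit_vector n)) k"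
      using that unfolding ell1_mult.rep_eq plus_ell1.rep_eq scaleR_ell1.rep_eq scaleC_ell1.rep_eq
        unit_vector.rep_eq scaleR_conv_of_real
      by (cases "k = m"; cases "k = n") (simp_all add: power2_eq_square algebra_simps)
  qed
  from this[OF assms] show ?thesis
    unfolding perturbation_def .
qed

section \<open>Limits of perturbations along a free ultrafilter\<close>

context
  fixes F :: "nat filter"
  assumes F: "ultrafilter F" "F \<le> sequentially"
begin

lemma tendsto_fst_iterated: "(f \<longlongrightarrow> l) F \<Longrightarrow> ((\<lambda>p. f (fst p)) \<longlongrightarrow> l) (iterated_filter F)"
  and tendsto_snd_iterated: "(f \<longlongrightarrow> l) F \<Longrightarrow> ((\<lambda>p. f (snd p)) \<longlongrightarrow> l) (iterated_filter F)"
  using filterlim_compose[OF _ filterlim_fst_iterated] filterlim_compose[OF _ filterlim_snd_iterated] by blast+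

lemma scale_tendsto: "((\<lambda>p. 1 - inverse (real (Suc (fst p)))) \<longlongrightarrow> 1) (iterated_filter F)"
proof (rule tendsto_fst_iterated, rule tendsto_mono[OF F(2)])
  show "(\<lambda>n. 1 - inverse (real (Suc n))) \<longlonglongrightarrow> 1"
    using tendsto_diff[OF tendsto_const LIMSEQ_inverse_real_of_nat, of "1"] by simp
qed

text \<open>\<open>F\<close> contains every tail, so the inner index eventually exceeds any fixed
  outer one.\<close>

lemma eventually_fst_neq_snd: "eventually (\<lambda>p. fst p \<noteq> snd p) (iterated_filter F)"
proof -
  have "eventually (\<lambda>m. n \<noteq> m) F" for n
    using F(2) by (rule filter_leD) (use eventually_gt_at_top[of n] in eventually_elim, simp)
  then show ?thesis
    by (simp add: eventually_iterated_filter)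
qed

lemma ell1_coord_tendsto: "(ell1_coord z \<longlongrightarrow> 0) F"
  by (rule tendsto_mono[OF F(2)], rule tendsto_norm_zero_cancel, rule summable_LIMSEQ_zero[OF summable_ell1])

text \<open>Linear functionals see only \<open>\<alpha> + \<beta>\<close>, so different splittings
  of one coefficient lead to the same fiber.\<close>

lemma tendsto_perturbation:
  assumes "((\<lambda>n. cdual_apply x' (unit_vector n)) \<longlongrightarrow> l) F"
  shows "((\<lambda>p. cdual_apply x' (perturbation z \<alpha> \<beta> p)) \<longlongrightarrow> cdual_apply x' z + (\<alpha> + \<beta>) * l) (iterated_filter F)"
proof -
  have "((\<lambda>p. (1 - inverse (real (Suc (fst p)))) *\<^sub>R
      (cdual_apply x' z + \<alpha> * cdual_apply x' (unit_vector (fst p)) + \<beta> * cdual_apply x' (unit_vector (snd p))))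
      \<longlongrightarrow> 1 *\<^sub>R (cdual_apply x' z + \<alpha> * l + \<beta> * l)) (iterated_filter F)"
    by (intro tendsto_intros scale_tendsto tendsto_fst_iterated[OF assms] tendsto_snd_iterated[OF assms])
  then show ?thesis
    unfolding perturbation_def by (simp add: algebra_simps)
qed

text \<open>The sum of squares does depend on the splitting. The cross terms with \<open>z\<close>
  vanish because its coordinates tend to 0, and coinciding indices are eventually excluded.\<close>

lemma tendsto_perturbation_square:
  assumes "((\<lambda>n. cdual_apply d (unit_vector n)) \<longlongrightarrow> l) F"
  shows "((\<lambda>p. cdual_apply d (ell1_mult (perturbation z \<alpha> \<beta> p) (perturbation z \<alpha> \<beta> p))) \<longlongrightarrow>
    cdual_apply d (ell1_mult z z) + (\<alpha>\<^sup>2 + \<beta>\<^sup>2) * l) (iterated_filter F)"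
proof -
  have "((\<lambda>p. complex_of_real ((1 - inverse (real (Suc (fst p))))\<^sup>2) *
      (cdual_apply d (ell1_mult z z)
        + (2 * \<alpha> * ell1_coord z (fst p) + \<alpha>\<^sup>2) * cdual_apply d (unit_vector (fst p))
        + (2 * \<beta> * ell1_coord z (snd p) + \<beta>\<^sup>2) * cdual_apply d (unit_vector (snd p))))
      \<longlongrightarrow> complex_of_real (1\<^sup>2) * (cdual_apply d (ell1_mult z z)
        + (2 * \<alpha> * 0 + \<alpha>\<^sup>2) * l + (2 * \<beta> * 0 + \<beta>\<^sup>2) * l)) (iterated_filter F)"
    by (intro tendsto_intros scale_tendsto tendsto_fst_iterated[OF assms] tendsto_snd_iterated[OF assms]
        tendsto_fst_iterated[OF ell1_coord_tendsto] tendsto_snd_iterated[OF ell1_coord_tendsto])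
  then have "((\<lambda>p. complex_of_real ((1 - inverse (real (Suc (fst p))))\<^sup>2) *
      (cdual_apply d (ell1_mult z z)
        + (2 * \<alpha> * ell1_coord z (fst p) + \<alpha>\<^sup>2) * cdual_apply d (unit_vector (fst p))
        + (2 * \<beta> * ell1_coord z (snd p) + \<beta>\<^sup>2) * cdual_apply d (unit_vector (snd p))))
      \<longlongrightarrow> cdual_apply d (ell1_mult z z) + (\<alpha>\<^sup>2 + \<beta>\<^sup>2) * l) (iterated_filter F)"
    by (simp add: algebra_simps)
  then show ?thesis
    by (rule Lim_transform_eventually, use eventually_fst_neq_snd in eventually_elim) (simp add: perturbation_square)
qed

lemma limit_character_in_fiber:
  assumes "norm z + cmod \<alpha> + cmod \<beta> \<le> 1"
    and \<omega>: "\<And>x' l. ((\<lambda>n. cdual_apply x' (unit_vector n)) \<longlongrightarrow> l) F \<Longrightarrow> cdual_apply \<omega> x' = (\<alpha> + \<beta>) * l"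
  shows "limit_character (iterated_filter F) (perturbation z \<alpha> \<beta>) \<in> fiber (canonical_embedding z + \<omega>)"
proof -
  note G = ultrafilter_iterated[OF F(1)] and ball = perturbation_in_ball[OF assms(1)]
  have "limit_character (iterated_filter F) (perturbation z \<alpha> \<beta>) (Au_of_cdual x') =
      cdual_apply x' z + cdual_apply \<omega> x'" for x'
  proof -
    have "bounded (range (\<lambda>n. cdual_apply x' (unit_vector n)))"
      using cdual_unit_vector_le[of x'] by (auto simp: bounded_iff)
    with F(1) obtain l where l: "((\<lambda>n. cdual_apply x' (unit_vector n)) \<longlongrightarrow> l) F"
      by (rule ultrafilter_tendsto)
    show ?thesis
      by (rule limit_character_eqI[OF G])
        (use tendsto_perturbation[OF l, of z \<alpha> \<beta>] ball \<omega>[OF l] in \<open>simp add: Au_of_cdual.rep_eq\<close>)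
  qed
  then show ?thesis
    unfolding fiber_def using limit_character_in_spectrum[OF G ball] by simp
qed

text \<open>For fixed \<open>N\<close> the coefficients of head and tail are eventually 0 and
  constant, which gives the value of the character exactly. Then, as \<open>N\<close> grows, the
  head at \<open>z\<close> tends to \<open>norm z\<close> and the tail terms at \<open>z\<close> and
  its square vanish.\<close>

lemma limit_character_peak:
  fixes v :: complex
  assumes "norm z + cmod \<alpha> + cmod \<beta> \<le> 1" and v: "cmod v \<le> 1"
  shows "(\<lambda>N. limit_character (iterated_filter F) (perturbation z \<alpha> \<beta>) (peak z v N)) \<longlonglongrightarrow>
    complex_of_real (norm z) * (norm z + 2 * (\<alpha> + \<beta>) * v) + (\<alpha>\<^sup>2 + \<beta>\<^sup>2) * v\<^sup>2"
proof -
  note G = ultrafilter_iterated[OF F(1)] and ball = perturbation_in_ball[OF assms(1)]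
  have ev: "eventually (\<lambda>n. N \<le> n) F" for N
    using F(2) by (simp add: le_sequentially)
  have L: "((\<lambda>n. cdual_apply (head_functional z N) (unit_vector n)) \<longlongrightarrow> 0) F"
    and T: "((\<lambda>n. cdual_apply (tail_functional u N) (unit_vector n)) \<longlongrightarrow> u) F" for N u
    by (rule tendsto_eventually, use ev[of N] in eventually_elim, simp)+
  have LT: "((\<lambda>n. cdual_apply (head_functional z N + 2 *\<^sub>C tail_functional v N) (unit_vector n)) \<longlongrightarrow> 0 + 2 * v) F" for N
    unfolding plus_cdual.rep_eq scaleC_cdual.rep_eq by (intro tendsto_intros L T)
  have "limit_character (iterated_filter F) (perturbation z \<alpha> \<beta>) (peak z v N) =
      (cdual_apply (head_functional z N) z + (\<alpha> + \<beta>) * 0) *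
        (cdual_apply (head_functional z N + 2 *\<^sub>C tail_functional v N) z + (\<alpha> + \<beta>) * (0 + 2 * v))
      + (cdual_apply (tail_functional (v\<^sup>2) N) (ell1_mult z z) + (\<alpha>\<^sup>2 + \<beta>\<^sup>2) * v\<^sup>2)" for N
  proof (rule limit_character_eqI[OF G])
    have "Au_apply (peak z v N) (perturbation z \<alpha> \<beta> p) =
        cdual_apply (head_functional z N) (perturbation z \<alpha> \<beta> p) *
          cdual_apply (head_functional z N + 2 *\<^sub>C tail_functional v N) (perturbation z \<alpha> \<beta> p)
        + cdual_apply (tail_functional (v\<^sup>2) N) (ell1_mult (perturbation z \<alpha> \<beta> p) (perturbation z \<alpha> \<beta> p))" for p
      using ball by (simp add: peak_def plus_Au.rep_eq times_Au.rep_eq Au_of_cdual.rep_eq Au_square_of_cdual.rep_eq)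
    then show "((\<lambda>p. Au_apply (peak z v N) (perturbation z \<alpha> \<beta> p)) \<longlongrightarrow>
      (cdual_apply (head_functional z N) z + (\<alpha> + \<beta>) * 0) *
        (cdual_apply (head_functional z N + 2 *\<^sub>C tail_functional v N) z + (\<alpha> + \<beta>) * (0 + 2 * v))
      + (cdual_apply (tail_functional (v\<^sup>2) N) (ell1_mult z z) + (\<alpha>\<^sup>2 + \<beta>\<^sup>2) * v\<^sup>2)) (iterated_filter F)"
      using tendsto_add[OF tendsto_mult[OF tendsto_perturbation[OF L] tendsto_perturbation[OF LT]]
          tendsto_perturbation_square[OF T]] by simp
  qed
  moreover have "(\<lambda>N. (cdual_apply (head_functional z N) z + (\<alpha> + \<beta>) * 0) *
        (cdual_apply (head_functional z N) z + 2 * cdual_apply (tail_functional v N) z + (\<alpha> + \<beta>) * (0 + 2 * v))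
      + (cdual_apply (tail_functional (v\<^sup>2) N) (ell1_mult z z) + (\<alpha>\<^sup>2 + \<beta>\<^sup>2) * v\<^sup>2)) \<longlonglongrightarrow>
      (complex_of_real (norm z) + (\<alpha> + \<beta>) * 0) * (complex_of_real (norm z) + 2 * 0 + (\<alpha> + \<beta>) * (0 + 2 * v))
      + (0 + (\<alpha>\<^sup>2 + \<beta>\<^sup>2) * v\<^sup>2)"
    using v by (intro tendsto_intros head_functional_tendsto tail_functional_tendsto)
      (simp_all add: norm_power power_le_one)
  ultimately show ?thesis
    by (simp add: algebra_simps)
qed

end

theorem proposition4p6:
  fixes z'' \<omega> :: "ell1 cdual cdual" and z :: ell1
  assumes "z'' \<in> sphere 0 1"
    and "z'' = canonical_embedding z + \<omega>"
    and "z \<in> ball 0 1"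
    and "\<omega> \<in> c0_perp"
    and "\<omega> extreme_point_of ((\<lambda>\<eta>. norm \<omega> *\<^sub>R \<eta>) ` (cball 0 1 \<inter> c0_perp))"
  shows "\<exists>\<phi> \<in> fiber z''. gleason_part \<phi> \<noteq> gleason_part (evaluation z'')"
proof -
  define r where "r = norm \<omega>"
  have "norm (canonical_embedding z) \<le> norm z"
    by (rule norm_cdual_le) (use cdual_apply_le[of _ z] in \<open>simp_all add: mult.commute\<close>)
  then have ge: "1 \<le> norm z + r"
    using assms(1,2) norm_triangle_ineq[of "canonical_embedding z" \<omega>] by (simp add: r_def)
  \<comment> \<open>As \<open>norm z < 1\<close>, the part \<open>\<omega>\<close> cannot
    vanish.\<close>
  then have r: "0 < r" "\<omega> \<noteq> 0"
    using assms(3) by (auto simp: r_def)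
  obtain F c where F: "ultrafilter F" "F \<le> sequentially" and c: "cmod c = r"
    and \<omega>: "\<And>x' l. ((\<lambda>n. cdual_apply x' (unit_vector n)) \<longlongrightarrow> l) F \<Longrightarrow> cdual_apply \<omega> x' = c * l"
    using extreme_point_c0_perp[OF assms(4) r(2) assms(5)] unfolding r_def by metis
  \<comment> \<open>The phase for which \<open>c * v\<close> is the positive number
    \<open>r\<close>.\<close>
  define v where "v = cnj (sgn c)"
  have v: "cmod v = 1" and cv: "c * v = r"
    using r c cnj_sgn_mult[of c] by (auto simp: v_def norm_sgn mult.commute)
  have "cdual_apply \<omega> (head_functional z N + tail_functional v N) = complex_of_real r" for N
  proof -
    have "eventually (\<lambda>n. N \<le> n) F"
      using F(2) by (simp add: le_sequentially)
    then have "((\<lambda>n. cdual_apply (head_functional z N + tail_functional v N) (unit_vector n)) \<longlongrightarrow> v) F"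
      by (intro tendsto_eventually) (auto elim: eventually_mono)
    then show ?thesis
      using \<omega> cv by metis
  qed
  \<comment> \<open>Of this equality, the upper bound keeps the perturbed points in the ball and the
    lower bound brings the first limit of peak values up to 1.\<close>
  with ge have sum: "norm z + r = 1"
    using norm_add_le_head_tail[OF v, of \<omega> z r] r assms(1,2) by simp
  let ?\<chi> = "\<lambda>\<alpha> \<beta>. limit_character (iterated_filter F) (perturbation z \<alpha> \<beta>)"
  \<comment> \<open>The mass \<open>r\<close> is put on one coordinate or split evenly over two; the
    coefficients sum to \<open>c\<close> in both cases.\<close>
  have ball1: "norm z + cmod c + cmod 0 \<le> 1" and ball2: "norm z + cmod (c / 2) + cmod (c / 2) \<le> 1"
    using sum c by (simp_all add: norm_divide)
  have fib1: "?\<chi> c 0 \<in> fiber z''"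
    unfolding assms(2) using \<omega> by (intro limit_character_in_fiber[OF F ball1]) simp
  have fib2: "?\<chi> (c / 2) (c / 2) \<in> fiber z''"
    unfolding assms(2) using \<omega> by (intro limit_character_in_fiber[OF F ball2]) simp
  have "complex_of_real (norm z) * (norm z + 2 * (c + 0) * v) + (c\<^sup>2 + 0\<^sup>2) * v\<^sup>2 =
      complex_of_real ((norm z + r)\<^sup>2)"
    by (simp add: power2_eq_square algebra_simps flip: cv)
  then have lim1: "(\<lambda>N. ?\<chi> c 0 (peak z v N)) \<longlonglongrightarrow> 1"
    using limit_character_peak[OF F ball1, of v] v sum by simp
  \<comment> \<open>Even splitting halves the sum of squares, so the second limit falls short of 1
    by \<open>r\<^sup>2 / 2\<close>.\<close>
  have "complex_of_real (norm z) * (norm z + 2 * (c / 2 + c / 2) * v) + ((c / 2)\<^sup>2 + (c / 2)\<^sup>2) * v\<^sup>2 =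
      complex_of_real ((norm z + r)\<^sup>2 - r\<^sup>2 / 2)"
    by (simp add: power2_eq_square algebra_simps flip: cv)
  then have lim2: "(\<lambda>N. ?\<chi> (c / 2) (c / 2) (peak z v N)) \<longlonglongrightarrow> complex_of_real (1 - r\<^sup>2 / 2)"
    using limit_character_peak[OF F ball2, of v] v sum by simp
  have "r \<le> 1"
    using sum norm_ge_zero[of z] by linarith
  then have "r\<^sup>2 \<le> 1"
    using r by (simp add: abs_square_le_1)
  then have "cmod (complex_of_real (1 - r\<^sup>2 / 2)) \<le> 1"
    unfolding norm_of_real by simp
  moreover have "complex_of_real (1 - r\<^sup>2 / 2) \<noteq> 1"
    using r by (simp add: complex_eq_iff)
  ultimately have "functional_dist (?\<chi> c 0) (?\<chi> (c / 2) (c / 2)) \<ge> 2"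
    using fib1 fib2 norm_peak_le[OF v]
    by (intro functional_dist_ge_2[OF _ _ _ lim1 lim2]) (simp_all add: fiber_def)
  then have "gleason_part (?\<chi> c 0) \<noteq> gleason_part (?\<chi> (c / 2) (c / 2))"
    using fib1 fib2 by (intro gleason_part_neq) (simp_all add: fiber_def)
  \<comment> \<open>Two different parts cannot both be the part of
    \<open>evaluation z''\<close>.\<close>
  with fib1 fib2 show ?thesis
    by metis
qed

end
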